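(* Let $a>b>0$, $0<\lambda<b^2$, $c=\sqrt{a^2-b^2}$, let $E=\{\frac{x^2}{a^2}+\frac{y^2}{b^2}=1\}$ be the billiard table and $E_\lambda=\{\frac{x^2}{a^2-\lambda}+\frac{y^2}{b^2-\lambda}=1\}$ a confocal caustic, and put $e=\frac{a}{c}$, $f=\frac{\sqrt{a^2-\lambda}}{c}$. Let $\rho$ be the rotation number of the billiard in $E$ on the invariant curve corresponding to the caustic $E_\lambda$. Then the Mather $\beta$-function of the billiard in $E$ satisfies $$\beta(\rho)=\frac{2ce\sqrt{e^2-f^2}}{\sqrt{e^2-1}}-\frac{2cf}{K(k)}\bigl[K(k)E(\phi,k)-E(k)F(\phi,k)\bigr],$$ where $k=\frac1f$ and $\phi=\arcsin\sqrt{\frac{e^2-f^2}{e^2-1}}=\arcsin\frac{\sqrt\lambda}{b}$.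
   Context: Elliptic integrals: $F(\varphi,k)=\int_0^\varphi\frac{dt}{\sqrt{1-k^2\sin^2t}}$ (first kind), $E(\varphi,k)=\int_0^\varphi\sqrt{1-k^2\sin^2t}\,dt$ (second kind), and the complete integrals are $K(k)=F(\pi/2,k)$, $E(k)=E(\pi/2,k)$. Billiard trajectories in $E$ with one edge tangent to $E_\lambda$ have all edges tangent to $E_\lambda$ (the trajectory circumscribes $E_\lambda$); they are traversed counterclockwise. The oriented lines tangent counterclockwise to $E_\lambda$ form the invariant curve of the billiard map corresponding to $E_\lambda$. The rotation number $\rho\in(0,\tfrac12)$ of this curve is the average number of turns around the centre per reflection: if a trajectory closes after $n$ reflections making $m$ turns, then $\rho=m/n$; in general, if $\theta_i$ is a continuously lifted polar angle of the $i$-th reflection point, with $0<\theta_{i+1}-\theta_i<2\pi$, then $\rho=\lim_{N\to\infty}\frac{\theta_N-\theta_0}{2\pi N}$. Mather $\beta$-function of the ellipse (with sign $+$ convention): $\beta(\rho)$ is the average length per edge of the billiard trajectories circumscribing $E_\lambda$. That is, for $\rho=m/n$ all the billiard trajectories circumscribing $E_\lambda$ are closed $n$-gons (Poncelet polygons) of the same perimeter and $\beta(m/n)$ is this perimeter divided by $n$; for arbitrary $\rho$, $\beta(\rho)=\lim_{N\to\infty}\frac1N\sum_{i=1}^N|P_{i-1}P_i|$ where $P_0,P_1,\dots$ are the consecutive reflection points of such a trajectory. The term "eccentricity" in this setting means $e=a/c$ for $E$ and $f=\sqrt{a^2-\lambda}/c$ for $E_\lambda$ (the reciprocals of the usual eccentricities).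 *)

theory Defs
  imports "HOL-Analysis.Analysis"
begin

text \<open>Elliptic integrals, with the modulus as parameter. The interval integral is
  oriented, so the amplitude may have either sign.\<close>

definition elliptic_F :: "real \<Rightarrow> real \<Rightarrow> real" where
  "elliptic_F \<phi> k = (LBINT t=0..\<phi>. 1 / sqrt (1 - k\<^sup>2 * (sin t)\<^sup>2))"

definition elliptic_E :: "real \<Rightarrow> real \<Rightarrow> real" where
  "elliptic_E \<phi> k = (LBINT t=0..\<phi>. sqrt (1 - k\<^sup>2 * (sin t)\<^sup>2))"

definition complete_K :: "real \<Rightarrow> real" where
  "complete_K k = elliptic_F (pi / 2) k"

definition complete_E :: "real \<Rightarrow> real" where
  "complete_E k = elliptic_E (pi / 2) k"

text \<open>The Euclidean plane is the type of complex numbers. The parameters \<open>A\<close>, \<open>B\<close> below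
  are the \<^emph>\<open>squares\<close> of the semi-axes, so that the table is \<open>ellipse (a\<^sup>2) (b\<^sup>2)\<close>
  and the confocal caustic is \<open>ellipse (a\<^sup>2 - l) (b\<^sup>2 - l)\<close>.\<close>

definition ellipse :: "real \<Rightarrow> real \<Rightarrow> complex set" where
  "ellipse A B = {z. (Re z)\<^sup>2 / A + (Im z)\<^sup>2 / B = 1}"

text \<open>Outward normal vector (half the gradient of the defining function), not normalised.\<close>

definition ellipse_normal :: "real \<Rightarrow> real \<Rightarrow> complex \<Rightarrow> complex" where
  "ellipse_normal A B z = Complex (Re z / A) (Im z / B)"

text \<open>The line through \<open>p\<close> and \<open>q\<close>, oriented from \<open>p\<close> to \<open>q\<close>, is tangent
  counterclockwise to the ellipse: it passes through a point \<open>T\<close> of the ellipse, and its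
  direction is that of the outward normal at \<open>T\<close> turned by a positive right angle
  (multiplication by the imaginary unit). This forces \<open>p \<noteq> q\<close>.\<close>

definition ccw_tangent :: "real \<Rightarrow> real \<Rightarrow> complex \<Rightarrow> complex \<Rightarrow> bool" where
  "ccw_tangent A B p q \<longleftrightarrow>
     (\<exists>T \<in> ellipse A B. T \<in> affine hull {p, q} \<and>
        (\<exists>s>0. q - p = s *\<^sub>R (\<i> * ellipse_normal A B T)))"

text \<open>Reflection of the vector \<open>u\<close> in the line orthogonal to \<open>n\<close>.\<close>

definition reflect_vec :: "complex \<Rightarrow> complex \<Rightarrow> complex" where
  "reflect_vec n u = u - (2 * (u \<bullet> n) / (n \<bullet> n)) *\<^sub>R n"

text \<open>Reflection points of a billiard trajectory inside \<open>ellipse A B\<close>; the last condition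
  is the reflection law for the unit directions of consecutive edges.\<close>

definition billiard_trajectory :: "real \<Rightarrow> real \<Rightarrow> (nat \<Rightarrow> complex) \<Rightarrow> bool" where
  "billiard_trajectory A B P \<longleftrightarrow>
     (\<forall>i. P i \<in> ellipse A B) \<and>
     (\<forall>i. P (Suc i) \<noteq> P i) \<and>
     (\<forall>i. sgn (P (Suc (Suc i)) - P (Suc i)) =
          reflect_vec (ellipse_normal A B (P (Suc i))) (sgn (P (Suc i) - P i)))"

definition circumscribing_trajectory ::
    "real \<Rightarrow> real \<Rightarrow> real \<Rightarrow> (nat \<Rightarrow> complex) \<Rightarrow> bool" where
  "circumscribing_trajectory a b l P \<longleftrightarrow>
     billiard_trajectory (a\<^sup>2) (b\<^sup>2) P \<and>
     (\<forall>i. ccw_tangent (a\<^sup>2 - l) (b\<^sup>2 - l) (P i) (P (Suc i)))"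

definition polar_angle_lift :: "(nat \<Rightarrow> complex) \<Rightarrow> (nat \<Rightarrow> real) \<Rightarrow> bool" where
  "polar_angle_lift P \<theta> \<longleftrightarrow>
     (\<forall>i. P i = rcis (cmod (P i)) (\<theta> i)) \<and>
     (\<forall>i. 0 < \<theta> (Suc i) - \<theta> i \<and> \<theta> (Suc i) - \<theta> i < 2 * pi)"

text \<open>Rotation number of the invariant curve of lines tangent counterclockwise to the caustic
  with parameter \<open>l\<close>: the common limit for all trajectories on this curve.\<close>

definition rotation_number :: "real \<Rightarrow> real \<Rightarrow> real \<Rightarrow> real" where
  "rotation_number a b l =
     (THE \<rho>. \<forall>P \<theta>. circumscribing_trajectory a b l P \<longrightarrow> polar_angle_lift P \<theta> \<longrightarrow>
        (\<lambda>N. (\<theta> N - \<theta> 0) / (2 * pi * real N)) \<longlonglongrightarrow> \<rho>)"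

text \<open>The \<open>\<beta>\<close>-function (sign convention \<open>+\<close>) as a function of the rotation number: the mean
  edge length common to all trajectories circumscribing a confocal elliptic caustic whose
  rotation number is \<open>\<rho>\<close>. The value is meaningful only for such \<open>\<rho>\<close>. For a closed
  \<open>n\<close>-gon the limit is the perimeter divided by \<open>n\<close>.\<close>

definition mather_beta :: "real \<Rightarrow> real \<Rightarrow> real \<Rightarrow> real" where
  "mather_beta a b \<rho> =
     (THE L. \<forall>l P. 0 < l \<longrightarrow> l < b\<^sup>2 \<longrightarrow> rotation_number a b l = \<rho> \<longrightarrow>
        circumscribing_trajectory a b l P \<longrightarrow>
        (\<lambda>N. (\<Sum>i=1..N. dist (P (i - 1)) (P i)) / real N) \<longlonglongrightarrow> L)"

end

theory Submission
  imports Defs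
begin

text \<open>Write points of the table as \<open>P s = (- a sin s, b cos s)\<close>. The chord between
  \<open>P (\<sigma> - d)\<close> and \<open>P (\<sigma> + d)\<close>, with \<open>0 < d < \<pi>/2\<close>, touches the caustic iff
  \<open>sin\<^sup>2 d = l (sin\<^sup>2 \<sigma> / a\<^sup>2 + cos\<^sup>2 \<sigma> / b\<^sup>2)\<close>; this defines \<open>d\<close> as a function of \<open>\<sigma>\<close>.
  At both ends of the chord \<open>sqrt (1 - k\<^sup>2 sin\<^sup>2 s)\<close> is proportional, with the same factor,
  to \<open>ds/d\<sigma>\<close>. Hence the increment of \<open>F(s, k)\<close> along the chord does not depend on \<open>\<sigma>\<close>, and
  the length of the chord is a constant plus \<open>sqrt (a\<^sup>2 - l)\<close> times the increment of
  \<open>E(s, k)\<close>. Since \<open>F\<close> and \<open>E\<close> differ from linear functions by periodic ones, the rotation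
  number and the mean length can be read off with bounded error. That \<open>\<beta>\<close> is a function of the
  rotation number needs in addition that the rotation number determines the caustic.\<close>

section \<open>Elliptic integrals and quasiperiodic functions\<close>

lemma one_minus_modulus_sin_pos:
  fixes k t :: real
  assumes "k\<^sup>2 < 1"
  shows "0 < 1 - k\<^sup>2 * (sin t)\<^sup>2"
proof -
  have "k\<^sup>2 * (sin t)\<^sup>2 \<le> k\<^sup>2 * 1"
    by (rule mult_left_mono) (auto simp: sin_squared_eq)
  then show ?thesis using assms by linarith
qed

lemma has_real_derivative_interval_integral:
  fixes f :: "real \<Rightarrow> real"
  assumes "continuous_on UNIV f"
  shows "((\<lambda>u. LBINT t=0..u. f t) has_real_derivative f x) (at x)"
proof -
  \<comment> \<open>The window \<open>{-r..r}\<close> has both the base point 0 and \<open>x\<close>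
    in its interior, so the derivative within it is the full derivative.\<close>
  define r where "r = \<bar>x\<bar> + 1"
  have "((\<lambda>u. LBINT t=ereal 0..u. f t) has_vector_derivative f x) (at x within {-r..r})"
    using assms by (intro interval_integral_FTC2) (auto simp: r_def intro: continuous_on_subset)
  moreover have "at x within {-r..r} = at x"
    by (rule at_within_interior) (auto simp: r_def)
  ultimately show ?thesis
    by (simp add: has_real_derivative_iff_has_vector_derivative zero_ereal_def)
qed

lemma elliptic_F_has_real_derivative:
  assumes "k\<^sup>2 < 1"
  shows "((\<lambda>x. elliptic_F x k) has_real_derivative 1 / sqrt (1 - k\<^sup>2 * (sin x)\<^sup>2)) (at x)"
proof -
  have "sqrt (1 - k\<^sup>2 * (sin t)\<^sup>2) \<noteq> 0" for t
    using one_minus_modulus_sin_pos[OF assms, of t] by simp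
  then show ?thesis
    unfolding elliptic_F_def
    by (intro has_real_derivative_interval_integral continuous_intros) auto
qed

lemma elliptic_E_has_real_derivative:
  "((\<lambda>x. elliptic_E x k) has_real_derivative sqrt (1 - k\<^sup>2 * (sin x)\<^sup>2)) (at x)"
  unfolding elliptic_E_def
  by (intro has_real_derivative_interval_integral continuous_intros)

lemma elliptic_F_strict_mono:
  assumes "k\<^sup>2 < 1" and "x < y"
  shows "elliptic_F x k < elliptic_F y k"
  using assms(2)
  by (rule DERIV_pos_imp_increasing)
     (use elliptic_F_has_real_derivative[OF assms(1)] one_minus_modulus_sin_pos[OF assms(1)]
      in \<open>auto intro!: exI\<close>)

lemma eq_constant_if_derivative_0:
  fixes f :: "real \<Rightarrow> real"
  assumes "\<And>x. (f has_real_derivative 0) (at x)"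
  shows "f x = f y"
  using DERIV_isconst_all assms by blast

text \<open>Both \<open>f (- x) + f x\<close> and \<open>f (x + 2 * p) - f x\<close> have derivative
  0; the constants are read off at 0 and at \<open>- p\<close>. With \<open>p = pi / 2\<close> the
  increment \<open>2 * f p\<close> is twice the complete integral.\<close>

lemma antiderivative_of_even_periodic:
  fixes f f' :: "real \<Rightarrow> real"
  assumes deriv: "\<And>x. (f has_real_derivative f' x) (at x)"
    and "f 0 = 0" and even: "\<And>x. f' (- x) = f' x" and periodic: "\<And>x. f' (x + 2 * p) = f' x"
  shows "f (- x) = - f x" and "f (x + 2 * p) = f x + 2 * f p"
proof -
  have neg: "((\<lambda>x. f (- x)) has_real_derivative - f' (- x)) (at x)" for x
    using DERIV_mirror[of f "f' (- x)" x] deriv by simp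
  have "((\<lambda>x. f (- x) + f x) has_real_derivative 0) (at x)" for x
    using DERIV_add[OF neg[of x] deriv[of x]] even by simp
  then have "f (- x) + f x = f (- 0) + f 0" for x
    by (rule eq_constant_if_derivative_0)
  then have "f (- x) + f x = 0" for x using \<open>f 0 = 0\<close> by (simp only: minus_zero)
  then have odd: "f (- x) = - f x" for x by (simp only: eq_neg_iff_add_eq_0)
  then show "f (- x) = - f x" .
  have "((\<lambda>x. f (x + 2 * p)) has_real_derivative f' (x + 2 * p)) (at x)" for x
    using deriv DERIV_shift by blast
  then have "((\<lambda>x. f (x + 2 * p) - f x) has_real_derivative 0) (at x)" for x
    using DERIV_diff[OF _ deriv[of x]] periodic by fastforce
  then have "f (x + 2 * p) - f x = f (- p + 2 * p) - f (- p)"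
    by (rule eq_constant_if_derivative_0)
  with odd[of p] show "f (x + 2 * p) = f x + 2 * f p" by simp
qed

lemma elliptic_0 [simp]: "elliptic_F 0 k = 0" "elliptic_E 0 k = 0"
  by (simp_all add: elliptic_F_def elliptic_E_def flip: zero_ereal_def)

lemma elliptic_F_minus: "k\<^sup>2 < 1 \<Longrightarrow> elliptic_F (- x) k = - elliptic_F x k"
  and elliptic_F_plus_pi: "k\<^sup>2 < 1 \<Longrightarrow> elliptic_F (x + pi) k = elliptic_F x k + 2 * complete_K k"
  using antiderivative_of_even_periodic[OF elliptic_F_has_real_derivative, of k "pi / 2" x]
  by (simp_all add: complete_K_def)

lemma elliptic_E_minus: "elliptic_E (- x) k = - elliptic_E x k"
  and elliptic_E_plus_pi: "elliptic_E (x + pi) k = elliptic_E x k + 2 * complete_E k"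
  using antiderivative_of_even_periodic[OF elliptic_E_has_real_derivative, of k "pi / 2" x]
  by (simp_all add: complete_E_def)

lemma complete_K_pos: "k\<^sup>2 < 1 \<Longrightarrow> 0 < complete_K k"
  unfolding complete_K_def using elliptic_F_strict_mono[of k 0 "pi / 2"] by simp

section \<open>Periodic and quasiperiodic functions of a real variable\<close>

lemma periodic_shift:
  fixes h :: "real \<Rightarrow> 'a"
  assumes "\<And>x. h (x + p) = h x"
  shows "h (x + of_int n * p) = h x"
proof -
  have nat: "h (x + real n * p) = h x" for x and n :: nat
  proof (induction n)
    case (Suc n)
    have "h (x + real (Suc n) * p) = h (x + real n * p + p)" by (simp add: algebra_simps)
    also have "\<dots> = h x" using assms Suc by (rule trans)
    finally show ?case .
  qed simp
  show ?thesis
  proof (cases "0 \<le> n")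
    case True
    then show ?thesis using nat[of x "nat n"] by simp
  next
    case False
    then show ?thesis using nat[of "x + of_int n * p" "nat (- n)"] by simp
  qed
qed

lemma periodic_attained:
  fixes h :: "real \<Rightarrow> 'a"
  assumes "\<And>x. h (x + p) = h x" and "0 < p"
  obtains y where "y \<in> {0..p}" and "h y = h x"
proof
  define n where "n = \<lfloor>x / p\<rfloor>"
  have "of_int n \<le> x / p" "x / p < of_int n + 1" unfolding n_def by linarith+
  then show "x + of_int (- n) * p \<in> {0..p}" using \<open>0 < p\<close> by (simp add: field_simps)
  show "h (x + of_int (- n) * p) = h x" by (rule periodic_shift) (fact assms)
qed

text \<open>Subtracting the line of slope \<open>d / p\<close> leaves a continuous periodic
  function, which is bounded because it is bounded on one period.\<close>

lemma continuous_quasiperiodic_bounded: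
  fixes f :: "real \<Rightarrow> real"
  assumes cont: "continuous_on UNIV f" and period: "\<And>x. f (x + p) = f x + d" and "0 < p"
  obtains C where "\<And>x y. \<bar>(f x - f y) - d / p * (x - y)\<bar> \<le> C"
proof -
  define h where "h = (\<lambda>x. f x - d / p * x)"
  have h: "h (x + p) = h x" for x
    using \<open>0 < p\<close> by (simp only: h_def period) (simp add: field_simps)
  have "compact (h ` {0..p})"
    unfolding h_def
    by (intro compact_continuous_image continuous_intros continuous_on_subset[OF cont]) auto
  then obtain B where B: "\<And>y. y \<in> {0..p} \<Longrightarrow> \<bar>h y\<bar> \<le> B"
    using compact_imp_bounded bounded_real by (metis imageI)
  have "\<bar>h x\<bar> \<le> B" for x
  proof -
    obtain y where "y \<in> {0..p}" and "h y = h x"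
      using periodic_attained[of h p x, OF h \<open>0 < p\<close>] .
    then show ?thesis using B[of y] by simp
  qed
  then have "\<bar>h x - h y\<bar> \<le> B + B" for x y
    using abs_triangle_ineq4[of "h x" "h y"] by (meson add_mono order_trans)
  moreover have "h x - h y = (f x - f y) - d / p * (x - y)" for x y
    unfolding h_def right_diff_distrib by linarith
  ultimately show ?thesis by (intro that[of "B + B"]) metis
qed

lemma bounded_deviation_LIMSEQ:
  fixes x :: "nat \<Rightarrow> real"
  assumes "\<And>N. \<bar>x N - real N * y\<bar> \<le> C"
  shows "(\<lambda>N. x N / real N) \<longlonglongrightarrow> y"
proof -
  have "(\<lambda>N. x N / real N - y) \<longlonglongrightarrow> 0"
  proof (rule Lim_null_comparison)
    show "\<forall>\<^sub>F N in sequentially. norm (x N / real N - y) \<le> C / real N"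
    proof (rule eventually_sequentiallyI[of 1])
      fix N :: nat assume "1 \<le> N"
      then have "x N / real N - y = (x N - real N * y) / real N" by (simp add: field_simps)
      then show "norm (x N / real N - y) \<le> C / real N"
        using assms[of N] \<open>1 \<le> N\<close> by (simp add: divide_right_mono)
    qed
    show "(\<lambda>N. C / real N) \<longlonglongrightarrow> 0" by (rule lim_const_over_n)
  qed
  then show ?thesis by (simp add: LIM_zero_iff)
qed

section \<open>Chords tangent to a confocal caustic\<close>

text \<open>The usual parametrisation at the eccentric angle \<open>s + pi / 2\<close>. Counting
  from the end of the minor axis makes \<open>s\<close> itself the amplitude of the elliptic
  integrals.\<close>

definition ellipse_point :: "real \<Rightarrow> real \<Rightarrow> real \<Rightarrow> complex" where
  "ellipse_point a b s = Complex (- (a * sin s)) (b * cos s)"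

lemma ellipse_point_sel [simp]:
  "Re (ellipse_point a b s) = - (a * sin s)" "Im (ellipse_point a b s) = b * cos s"
  by (simp_all add: ellipse_point_def)

lemma ellipse_point_in_ellipse:
  "a \<noteq> 0 \<Longrightarrow> b \<noteq> 0 \<Longrightarrow> ellipse_point a b s \<in> ellipse (a\<^sup>2) (b\<^sup>2)"
  by (simp add: ellipse_def power_mult_distrib)

lemma ellipse_point_after:
  assumes "z \<in> ellipse (a\<^sup>2) (b\<^sup>2)" and "a \<noteq> 0" "b \<noteq> 0"
  obtains s where "z = ellipse_point a b s" and "u \<le> s" and "s < u + 2 * pi"
proof -
  have "(Im z / b)\<^sup>2 + (- Re z / a)\<^sup>2 = 1"
    using assms(1) by (simp add: ellipse_def power_divide add.commute)
  then obtain t where t: "Im z / b = cos t" "- Re z / a = sin t"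
    using sincos_total_2pi_le by metis
  \<comment> \<open>This \<open>n\<close> puts \<open>s\<close> into the window open at
    \<open>u\<close> and closed at \<open>u + 2 * pi\<close>; its right end is traded for
    \<open>u\<close> below.\<close>
  define n where "n = \<lfloor>(u - t) / (2 * pi)\<rfloor> + 1"
  have n: "of_int n - 1 \<le> (u - t) / (2 * pi)" "(u - t) / (2 * pi) < of_int n"
    unfolding n_def by linarith+
  define s where "s = t + 2 * pi * of_int n"
  have "u < s" "s \<le> u + 2 * pi"
    using n by (simp_all add: s_def field_simps)
  have z: "z = ellipse_point a b s"
  proof -
    have "sin s = sin t" "cos s = cos t"
      by (simp_all add: s_def sin_add cos_add)
    then show ?thesis
      using t assms(2,3) by (auto simp: complex_eq_iff field_simps)
  qed
  show ?thesis
  proof (cases "s < u + 2 * pi")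
    case True
    then show ?thesis using that z \<open>u < s\<close> by simp
  next
    case False
    with \<open>s \<le> u + 2 * pi\<close> have "s = u + 2 * pi" by simp
    then show ?thesis using that[of u] z by (simp add: ellipse_point_def)
  qed
qed

text \<open>The chord is parallel to the velocity of the parametrisation at the midpoint parameter,
  the vector on the right.\<close>

lemma ellipse_point_diff:
  "ellipse_point a b (\<sigma> + d) - ellipse_point a b (\<sigma> - d)
     = (2 * sin d) *\<^sub>R Complex (- (a * cos \<sigma>)) (- (b * sin \<sigma>))"
  by (simp add: complex_eq_iff sin_add sin_diff cos_add cos_diff algebra_simps)

section \<open>The step function of a fixed caustic\<close>

locale confocal =
  fixes a b l :: real
  assumes b_pos: "0 < b" and b_less_a: "b < a" and l_pos: "0 < l" and l_less: "l < b\<^sup>2"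
begin

abbreviation P where "P \<equiv> ellipse_point a b"

text \<open>The usual eccentricity of the caustic, focal distance over major semi-axis.\<close>

definition modulus :: real where "modulus = sqrt (a\<^sup>2 - b\<^sup>2) / sqrt (a\<^sup>2 - l)"

abbreviation q where "q \<sigma> \<equiv> l * ((sin \<sigma> / a)\<^sup>2 + (cos \<sigma> / b)\<^sup>2)"

definition half_step :: "real \<Rightarrow> real" where "half_step \<sigma> = arcsin (sqrt (q \<sigma>))"

text \<open>Up to sign, half the derivative of \<open>q\<close>.\<close>

definition skew :: "real \<Rightarrow> real" where
  "skew \<sigma> = l * (a\<^sup>2 - b\<^sup>2) / (a\<^sup>2 * b\<^sup>2) * sin \<sigma> * cos \<sigma>"

lemma a_pos: "0 < a" using b_pos b_less_a by simp

lemma b2_less_a2: "b\<^sup>2 < a\<^sup>2" using b_pos b_less_a by (simp add: power_strict_mono)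

lemma l_less_a2: "l < a\<^sup>2" using b2_less_a2 l_less by simp

lemma modulus_sq: "modulus\<^sup>2 = (a\<^sup>2 - b\<^sup>2) / (a\<^sup>2 - l)"
  using b2_less_a2 l_less_a2 by (simp add: modulus_def power_divide)

lemma modulus_sq_less_1: "modulus\<^sup>2 < 1"
  unfolding modulus_sq using b2_less_a2 l_less_a2 l_less by (simp add: field_simps)

lemma q_pos: "0 < q \<sigma>"
proof -
  have "sin \<sigma> \<noteq> 0 \<or> cos \<sigma> \<noteq> 0"
    using sin_zero_abs_cos_one by fastforce
  then have "0 < (sin \<sigma> / a)\<^sup>2 + (cos \<sigma> / b)\<^sup>2"
    using a_pos b_pos by (auto intro: add_pos_nonneg add_nonneg_pos)
  then show ?thesis using l_pos by simp
qed

lemma q_altdef: "q \<sigma> = l * (a\<^sup>2 - (a\<^sup>2 - b\<^sup>2) * (sin \<sigma>)\<^sup>2) / (a\<^sup>2 * b\<^sup>2)"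
  using a_pos b_pos by (simp add: cos_squared_eq field_simps)

lemma q_less_1: "q \<sigma> < 1"
proof -
  have "q \<sigma> \<le> l * a\<^sup>2 / (a\<^sup>2 * b\<^sup>2)"
    unfolding q_altdef using l_pos b2_less_a2
    by (intro divide_right_mono mult_left_mono) auto
  also have "\<dots> < 1" using l_less a_pos b_pos by simp
  finally show ?thesis .
qed

lemma sqrt_q_bounds: "0 < sqrt (q \<sigma>)" "sqrt (q \<sigma>) < 1"
  using q_pos[of \<sigma>] q_less_1[of \<sigma>] by simp_all

lemma sin_half_step: "sin (half_step \<sigma>) = sqrt (q \<sigma>)"
  unfolding half_step_def using sqrt_q_bounds[of \<sigma>] by (intro sin_arcsin) linarith+

lemma half_step_less: "half_step \<sigma> < pi / 2"
  unfolding half_step_def using sqrt_q_bounds[of \<sigma>] arcsin_lt_bounded[of "sqrt (q \<sigma>)"] by linarith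

lemma half_step_pos: "0 < half_step \<sigma>"
  using arcsin_less_arcsin[of 0 "sqrt (q \<sigma>)"] sqrt_q_bounds[of \<sigma>] by (simp add: half_step_def)

lemma sin_half_step_pos: "0 < sin (half_step \<sigma>)"
  and cos_half_step_pos: "0 < cos (half_step \<sigma>)"
  using half_step_pos[of \<sigma>] half_step_less[of \<sigma>]
  by (auto intro: sin_gt_zero cos_gt_zero)

lemma sin_half_step_sq: "(sin (half_step \<sigma>))\<^sup>2 = q \<sigma>"
  unfolding sin_half_step using q_pos[of \<sigma>] by (intro real_sqrt_pow2) simp

lemma half_step_unique:
  assumes "0 < d" "d < pi / 2" "(sin d)\<^sup>2 = q \<sigma>"
  shows "d = half_step \<sigma>"
proof -
  have "0 < sin d" using assms(1,2) by (intro sin_gt_zero) auto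
  then have "sqrt (q \<sigma>) = sin d" by (simp flip: assms(3))
  then show ?thesis
    unfolding half_step_def using assms(1,2) by (simp add: arcsin_sin)
qed

lemma half_step_periodic: "half_step (\<sigma> + pi) = half_step \<sigma>"
  by (simp add: half_step_def)

text \<open>The chord with midpoint parameter 0 is the reference chord that fixes all constants; its
  half step is the amplitude \<open>\<phi>\<close> of the theorem.\<close>

lemma half_step_0: "half_step 0 = arcsin (sqrt l / b)"
  using b_pos by (simp add: half_step_def real_sqrt_mult power_divide real_sqrt_divide)

lemma q_has_real_derivative: "(q has_real_derivative - 2 * skew \<sigma>) (at \<sigma>)"
  unfolding skew_def using a_pos b_pos
  by (auto intro!: derivative_eq_intros) (simp add: field_simps power2_eq_square)

lemma half_step_has_real_derivative:
  "(half_step has_real_derivative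
      - (skew \<sigma>) / (sin (half_step \<sigma>) * cos (half_step \<sigma>))) (at \<sigma>)"
proof -
  have "((\<lambda>\<sigma>. arcsin (sqrt (q \<sigma>))) has_real_derivative
      inverse (sqrt (1 - (sqrt (q \<sigma>))\<^sup>2)) * (inverse (sqrt (q \<sigma>)) / 2 * (- 2 * skew \<sigma>))) (at \<sigma>)"
    using sqrt_q_bounds[of \<sigma>] q_pos[of \<sigma>]
    by (intro DERIV_chain2[OF DERIV_arcsin] DERIV_chain2[OF DERIV_real_sqrt] q_has_real_derivative) linarith+
  moreover have "sqrt (1 - (sqrt (q \<sigma>))\<^sup>2) = cos (half_step \<sigma>)"
    using cos_half_step_pos[of \<sigma>] by (simp flip: cos_squared_eq sin_half_step)
  moreover have "(\<lambda>\<sigma>. arcsin (sqrt (q \<sigma>))) = half_step"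
    by (simp only: half_step_def[abs_def])
  moreover have "inverse y * (inverse x / 2 * (- 2 * z)) = - z / (x * y)" for x y z :: real
    by (simp add: field_simps)
  ultimately show ?thesis
    by (simp only: sin_half_step)
qed

end

text \<open>Here \<open>S\<close>, \<open>C\<close> stand for sine and cosine of
  \<open>\<sigma>\<close>, \<open>x\<close>, \<open>y\<close> for those of the half step and
  \<open>r\<close> for the skew, so \<open>S * y - C * x\<close> is the sine of one chord end. The
  hypotheses see \<open>x\<close> only through its square, so \<open>- x\<close> may replace
  \<open>x\<close> and gives the other end.\<close>

lemma confocal_identity:
  fixes a b l S C x y r :: real
  assumes SC: "S\<^sup>2 + C\<^sup>2 = 1" and xy: "x\<^sup>2 + y\<^sup>2 = 1" and nz: "a \<noteq> 0" "b \<noteq> 0"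
    and x: "a\<^sup>2 * b\<^sup>2 * x\<^sup>2 = l * (a\<^sup>2 - (a\<^sup>2 - b\<^sup>2) * S\<^sup>2)"
    and r: "a\<^sup>2 * b\<^sup>2 * r = l * (a\<^sup>2 - b\<^sup>2) * S * C"
  shows "l * (a\<^sup>2 - l - (a\<^sup>2 - b\<^sup>2) * (S * y - C * x)\<^sup>2) = a\<^sup>2 * b\<^sup>2 * (x * y + r)\<^sup>2"
proof -
  \<comment> \<open>Once the cross terms are matched through \<open>r\<close>, the claim reduces to
    this relation, which comes from multiplying the hypothesis on \<open>x\<close> by
    \<open>a\<^sup>2 - (a\<^sup>2 - b\<^sup>2) * C\<^sup>2\<close>.\<close>
  have "a\<^sup>2 * b\<^sup>2 * (x\<^sup>2 * (a\<^sup>2 - (a\<^sup>2 - b\<^sup>2) * C\<^sup>2)) = a\<^sup>2 * b\<^sup>2 * (l + (a\<^sup>2 - b\<^sup>2) * S * C * r)"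
    using SC x r by algebra
  then have "x\<^sup>2 * (a\<^sup>2 - (a\<^sup>2 - b\<^sup>2) * C\<^sup>2) = l + (a\<^sup>2 - b\<^sup>2) * S * C * r"
    using nz by simp
  then show ?thesis using xy x r by algebra
qed

section \<open>Increments of the elliptic integrals along a tangent chord\<close>

context confocal
begin

abbreviation scale where "scale \<equiv> a * b / (sqrt l * sqrt (a\<^sup>2 - l))"

text \<open>This makes both chord ends move forward as \<open>\<sigma>\<close> grows and fixes the
  signs when roots are taken at the ends.\<close>

lemma skew_bound: "\<bar>skew \<sigma>\<bar> < sin (half_step \<sigma>) * cos (half_step \<sigma>)"
proof -
  have C: "(cos \<sigma>)\<^sup>2 = 1 - (sin \<sigma>)\<^sup>2" by (rule cos_squared_eq)
  \<comment> \<open>Clearing denominators in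
    \<open>q \<sigma> * (1 - q \<sigma>) - (skew \<sigma>)\<^sup>2\<close> gives this sum of a
    positive and a nonnegative term.\<close>
  have "0 < l * ((a\<^sup>2 - (a\<^sup>2 - b\<^sup>2) * (sin \<sigma>)\<^sup>2) * a\<^sup>2 * (b\<^sup>2 - l) + l * (a\<^sup>2 - b\<^sup>2) * b\<^sup>2 * (sin \<sigma>)\<^sup>2)"
  proof -
    have "(a\<^sup>2 - b\<^sup>2) * (sin \<sigma>)\<^sup>2 \<le> (a\<^sup>2 - b\<^sup>2) * 1"
      using b2_less_a2 by (intro mult_left_mono) (auto simp: sin_squared_eq)
    then have "0 < a\<^sup>2 - (a\<^sup>2 - b\<^sup>2) * (sin \<sigma>)\<^sup>2" using b_pos by (smt (verit) zero_less_power)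
    then show ?thesis
      using l_pos l_less a_pos b2_less_a2
      by (intro mult_pos_pos add_pos_nonneg mult_nonneg_nonneg) auto
  qed
  also have "\<dots> = (a\<^sup>2 * b\<^sup>2)\<^sup>2 * (q \<sigma> * (1 - q \<sigma>) - (skew \<sigma>)\<^sup>2)"
    using a_pos b_pos unfolding skew_def q_altdef power_mult_distrib C power_divide
    by (simp add: field_simps power2_eq_square)
  finally have "(skew \<sigma>)\<^sup>2 < q \<sigma> * (1 - q \<sigma>)"
    using a_pos b_pos by (simp add: zero_less_mult_iff)
  also have "\<dots> = (sin (half_step \<sigma>) * cos (half_step \<sigma>))\<^sup>2"
    by (simp only: power_mult_distrib cos_squared_eq sin_half_step_sq)
  finally show ?thesis
    using sin_half_step_pos[of \<sigma>] cos_half_step_pos[of \<sigma>] by (intro power2_less_imp_less[of "\<bar>skew \<sigma>\<bar>"]) simp_all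
qed

lemma sqrt_modulus_step:
  shows "sqrt (1 - modulus\<^sup>2 * (sin (\<sigma> - half_step \<sigma>))\<^sup>2)
      = scale * (sin (half_step \<sigma>) * cos (half_step \<sigma>) + skew \<sigma>)"
    and "sqrt (1 - modulus\<^sup>2 * (sin (\<sigma> + half_step \<sigma>))\<^sup>2)
      = scale * (sin (half_step \<sigma>) * cos (half_step \<sigma>) - skew \<sigma>)"
proof -
  \<comment> \<open>One computation serves both ends: \<open>x\<close> is the sine of the half step
    or its negative. Afterwards \<open>skew_bound\<close> removes the absolute value.\<close>
  have *: "sqrt (1 - modulus\<^sup>2 * (sin \<sigma> * cos (half_step \<sigma>) - cos \<sigma> * x)\<^sup>2)
      = scale * \<bar>x * cos (half_step \<sigma>) + skew \<sigma>\<bar>"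
    if "x\<^sup>2 = (sin (half_step \<sigma>))\<^sup>2" for x
  proof -
    let ?z = "sin \<sigma> * cos (half_step \<sigma>) - cos \<sigma> * x"
    have "a\<^sup>2 * b\<^sup>2 * x\<^sup>2 = l * (a\<^sup>2 - (a\<^sup>2 - b\<^sup>2) * (sin \<sigma>)\<^sup>2)"
      using a_pos b_pos unfolding that sin_half_step_sq q_altdef by simp
    then have "l * (a\<^sup>2 - l - (a\<^sup>2 - b\<^sup>2) * ?z\<^sup>2) = a\<^sup>2 * b\<^sup>2 * (x * cos (half_step \<sigma>) + skew \<sigma>)\<^sup>2"
      using that a_pos b_pos by (intro confocal_identity) (auto simp: skew_def)
    moreover have "1 - modulus\<^sup>2 * ?z\<^sup>2 = l * (a\<^sup>2 - l - (a\<^sup>2 - b\<^sup>2) * ?z\<^sup>2) / (l * (a\<^sup>2 - l))"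
      unfolding modulus_sq using l_pos l_less_a2 by (simp add: field_simps)
    ultimately have "1 - modulus\<^sup>2 * ?z\<^sup>2 = a\<^sup>2 * b\<^sup>2 * (x * cos (half_step \<sigma>) + skew \<sigma>)\<^sup>2 / (l * (a\<^sup>2 - l))"
      by simp
    then show ?thesis
      using a_pos b_pos by (simp add: real_sqrt_mult real_sqrt_divide)
  qed
  show "sqrt (1 - modulus\<^sup>2 * (sin (\<sigma> - half_step \<sigma>))\<^sup>2)
      = scale * (sin (half_step \<sigma>) * cos (half_step \<sigma>) + skew \<sigma>)"
    using *[of "sin (half_step \<sigma>)"] skew_bound[of \<sigma>] by (simp add: sin_diff)
  show "sqrt (1 - modulus\<^sup>2 * (sin (\<sigma> + half_step \<sigma>))\<^sup>2)
      = scale * (sin (half_step \<sigma>) * cos (half_step \<sigma>) - skew \<sigma>)"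
    using *[of "- sin (half_step \<sigma>)"] skew_bound[of \<sigma>] by (simp add: sin_add)
qed

lemma step_has_real_derivative:
  defines "D \<equiv> \<lambda>\<sigma>. sin (half_step \<sigma>) * cos (half_step \<sigma>)"
  shows "((\<lambda>\<sigma>. \<sigma> - half_step \<sigma>) has_real_derivative (D \<sigma> + skew \<sigma>) / D \<sigma>) (at \<sigma>)"
    and "((\<lambda>\<sigma>. \<sigma> + half_step \<sigma>) has_real_derivative (D \<sigma> - skew \<sigma>) / D \<sigma>) (at \<sigma>)"
proof -
  have "D \<sigma> > 0"
    unfolding D_def using sin_half_step_pos cos_half_step_pos by simp
  then have *: "1 - - skew \<sigma> / D \<sigma> = (D \<sigma> + skew \<sigma>) / D \<sigma>" "1 + - skew \<sigma> / D \<sigma> = (D \<sigma> - skew \<sigma>) / D \<sigma>"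
    by (simp_all add: field_simps)
  show "((\<lambda>\<sigma>. \<sigma> - half_step \<sigma>) has_real_derivative (D \<sigma> + skew \<sigma>) / D \<sigma>) (at \<sigma>)"
    unfolding *[symmetric] unfolding D_def
    by (intro DERIV_diff DERIV_ident half_step_has_real_derivative)
  show "((\<lambda>\<sigma>. \<sigma> + half_step \<sigma>) has_real_derivative (D \<sigma> - skew \<sigma>) / D \<sigma>) (at \<sigma>)"
    unfolding *[symmetric] unfolding D_def
    by (intro DERIV_add DERIV_ident half_step_has_real_derivative)
qed

text \<open>At each end the integrand is the reciprocal of \<open>scale\<close> times the numerator
  of the endpoint's derivative. The two contributions are therefore equal and cancel; oddness of F
  gives the constant at \<open>\<sigma> = 0\<close>.\<close>

lemma elliptic_F_step:
  "elliptic_F (\<sigma> + half_step \<sigma>) modulus - elliptic_F (\<sigma> - half_step \<sigma>) modulus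
     = 2 * elliptic_F (half_step 0) modulus"
proof -
  let ?f = "\<lambda>\<sigma>. elliptic_F (\<sigma> + half_step \<sigma>) modulus - elliptic_F (\<sigma> - half_step \<sigma>) modulus"
  have "(?f has_real_derivative 0) (at \<sigma>)" for \<sigma>
  proof -
    let ?D = "sin (half_step \<sigma>) * cos (half_step \<sigma>)"
    have "(?f has_real_derivative
        1 / (scale * (?D - skew \<sigma>)) * ((?D - skew \<sigma>) / ?D)
        - 1 / (scale * (?D + skew \<sigma>)) * ((?D + skew \<sigma>) / ?D)) (at \<sigma>)"
      unfolding sqrt_modulus_step[symmetric]
      by (intro DERIV_diff DERIV_chain2[OF elliptic_F_has_real_derivative[OF modulus_sq_less_1]]
          step_has_real_derivative)
    moreover have "?D - skew \<sigma> \<noteq> 0" "?D + skew \<sigma> \<noteq> 0"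
      using skew_bound[of \<sigma>] by linarith+
    ultimately show ?thesis by simp
  qed
  then have "?f \<sigma> = ?f 0" by (rule eq_constant_if_derivative_0)
  also have "\<dots> = 2 * elliptic_F (half_step 0) modulus"
    using elliptic_F_minus[OF modulus_sq_less_1, of "half_step 0"] by simp
  finally show ?thesis .
qed

lemma chord_norm_sq:
  "(a * cos \<sigma>)\<^sup>2 + (b * sin \<sigma>)\<^sup>2 = (a * b * sin (half_step \<sigma>))\<^sup>2 / l"
  unfolding power_mult_distrib sin_half_step_sq
  using a_pos b_pos l_pos by (simp add: field_simps)

text \<open>The length is twice the sine of the half step times the speed at the midpoint parameter,
  and by \<open>chord_norm_sq\<close> that speed is a multiple of the same sine.\<close>

lemma chord_length:
  "dist (P (\<sigma> - half_step \<sigma>)) (P (\<sigma> + half_step \<sigma>)) = 2 * a * b * q \<sigma> / sqrt l"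
proof -
  have "dist (P (\<sigma> - half_step \<sigma>)) (P (\<sigma> + half_step \<sigma>))
      = 2 * sin (half_step \<sigma>) * sqrt ((a * cos \<sigma>)\<^sup>2 + (b * sin \<sigma>)\<^sup>2)"
    using sin_half_step_pos[of \<sigma>]
    unfolding dist_norm norm_minus_commute[of "P (\<sigma> - half_step \<sigma>)"] ellipse_point_diff norm_scaleR
    by (simp add: cmod_def)
  also have "\<dots> = 2 * a * b * (sin (half_step \<sigma>))\<^sup>2 / sqrt l"
    unfolding chord_norm_sq using sin_half_step_pos[of \<sigma>] a_pos b_pos
    by (simp add: real_sqrt_divide power2_eq_square)
  finally show ?thesis by (simp only: sin_half_step_sq)
qed

definition base_length :: real where
  "base_length = 2 * a * sqrt l / b - 2 * sqrt (a\<^sup>2 - l) * elliptic_E (half_step 0) modulus"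

text \<open>For E the endpoint factors multiply, and the difference of their squares is a multiple
  of the skew. The chord length is a multiple of \<open>q\<close>, whose derivative is one as well,
  and the constants match.\<close>

lemma chord_length_elliptic_E:
  "dist (P (\<sigma> - half_step \<sigma>)) (P (\<sigma> + half_step \<sigma>)) = base_length + sqrt (a\<^sup>2 - l) *
     (elliptic_E (\<sigma> + half_step \<sigma>) modulus - elliptic_E (\<sigma> - half_step \<sigma>) modulus)"
proof -
  let ?E = "\<lambda>\<sigma>. sqrt (a\<^sup>2 - l) *
     (elliptic_E (\<sigma> + half_step \<sigma>) modulus - elliptic_E (\<sigma> - half_step \<sigma>) modulus)"
  let ?f = "\<lambda>\<sigma>. 2 * a * b / sqrt l * q \<sigma> - ?E \<sigma>"
  have "(?f has_real_derivative 0) (at \<sigma>)" for \<sigma>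
  proof -
    let ?D = "sin (half_step \<sigma>) * cos (half_step \<sigma>)"
    have "?D > 0" using sin_half_step_pos cos_half_step_pos by simp
    have "(?f has_real_derivative
        2 * a * b / sqrt l * (- 2 * skew \<sigma>) - sqrt (a\<^sup>2 - l) *
        (scale * (?D - skew \<sigma>) * ((?D - skew \<sigma>) / ?D)
        - scale * (?D + skew \<sigma>) * ((?D + skew \<sigma>) / ?D))) (at \<sigma>)"
      unfolding sqrt_modulus_step[symmetric]
      by (intro DERIV_diff DERIV_cmult DERIV_chain2[OF elliptic_E_has_real_derivative]
          step_has_real_derivative q_has_real_derivative)
    moreover have "scale * (?D - skew \<sigma>) * ((?D - skew \<sigma>) / ?D)
        - scale * (?D + skew \<sigma>) * ((?D + skew \<sigma>) / ?D) = scale * (- 4 * skew \<sigma>)"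
    proof -
      have "K * (D - r) * ((D - r) / D) - K * (D + r) * ((D + r) / D) = K * (- 4 * r)"
        if "D > 0" for K D r :: real
        using that by (simp add: field_simps)
      then show ?thesis using \<open>?D > 0\<close> by blast
    qed
    moreover have "2 * a * b / sqrt l * (- 2 * r) - sqrt (a\<^sup>2 - l) * (scale * (- 4 * r)) = 0" for r
      using l_pos l_less_a2 by (simp add: field_simps)
    ultimately show ?thesis by (simp only:)
  qed
  then have "?f \<sigma> = ?f 0" by (rule eq_constant_if_derivative_0)
  also have "\<dots> = base_length"
    using a_pos b_pos l_pos elliptic_E_minus[of "half_step 0" modulus]
    by (simp add: base_length_def field_simps power2_eq_square)
  finally show ?thesis by (simp add: chord_length)
qed

end

section \<open>Polar angles and the reflection law\<close>

lemma abs_less_pi_half_if_cos_pos: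
  fixes x :: real
  assumes "\<bar>x\<bar> < 3 * pi / 2" and "0 < cos x"
  shows "\<bar>x\<bar> < pi / 2"
proof (rule ccontr)
  assume "\<not> \<bar>x\<bar> < pi / 2"
  then have "0 \<le> cos (\<bar>x\<bar> - pi)" using assms(1) by (intro cos_ge_zero) linarith+
  moreover have "cos (\<bar>x\<bar> - pi) = - cos x" by (simp add: cos_diff)
  ultimately show False using assms(2) by simp
qed

text \<open>The real part is the inner product with the unit vector at angle
  \<open>s + pi / 2\<close>, namely \<open>a * (sin s)\<^sup>2 + b * (cos s)\<^sup>2\<close>. So
  polar and eccentric angle differ by less than a quarter turn, modulo full turns.\<close>

lemma ellipse_point_rotated:
  assumes "0 < a" "0 < b"
  shows "0 < Re (ellipse_point a b s * cis (- (s + pi / 2)))"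
proof -
  have "0 < a * (sin s)\<^sup>2 + b * (cos s)\<^sup>2"
    using assms sin_zero_abs_cos_one[of s] by (cases "sin s = 0") (auto intro: add_pos_nonneg)
  moreover have "cos (- (s + pi / 2)) = - sin s" "sin (- (s + pi / 2)) = - cos s"
    unfolding cos_minus sin_minus by (simp_all add: cos_add sin_add)
  ultimately show ?thesis
    by (simp only: times_complex.sel cis.sel ellipse_point_sel) (simp add: power2_eq_square)
qed

lemma polar_angle_ellipse_point:
  assumes "0 < a" "0 < b" and "ellipse_point a b s = rcis (cmod (ellipse_point a b s)) \<theta>"
  shows "0 < cos (\<theta> - (s + pi / 2))"
proof -
  have "ellipse_point a b s * cis (- (s + pi / 2))
      = rcis (cmod (ellipse_point a b s)) (\<theta> - (s + pi / 2))"
    by (subst assms(3)) (simp only: rcis_def mult.assoc cis_mult add_uminus_conv_diff)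
  then have "0 < cmod (ellipse_point a b s) * cos (\<theta> - (s + pi / 2))"
    using ellipse_point_rotated[OF assms(1,2), of s] by simp
  then show ?thesis by (simp add: zero_less_mult_iff)
qed

text \<open>The cross product of two points of the ellipse, computed with either angle.\<close>

lemma sin_polar_angle_step:
  assumes "0 < a" "0 < b"
    and "ellipse_point a b s = rcis (cmod (ellipse_point a b s)) \<theta>"
    and "ellipse_point a b s' = rcis (cmod (ellipse_point a b s')) \<theta>'"
    and "0 < s' - s" "s' - s < pi"
  shows "0 < sin (\<theta>' - \<theta>)"
proof -
  define r where "r = cmod (ellipse_point a b s)"
  define r' where "r' = cmod (ellipse_point a b s')"
  have "- (a * sin s) = r * cos \<theta>" "b * cos s = r * sin \<theta>"
    using assms(3) unfolding complex_eq_iff r_def by simp_all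
  moreover have "- (a * sin s') = r' * cos \<theta>'" "b * cos s' = r' * sin \<theta>'"
    using assms(4) unfolding complex_eq_iff r'_def by simp_all
  ultimately have "r * r' * sin (\<theta>' - \<theta>) = a * b * sin (s' - s)"
    unfolding sin_diff by algebra
  moreover have "0 < sin (s' - s)" using assms(5,6) by (rule sin_gt_zero)
  ultimately have "0 < r * r' * sin (\<theta>' - \<theta>)" using assms(1,2) by simp
  then show ?thesis
    by (auto simp: zero_less_mult_iff r_def r'_def mult_less_0_iff)
qed

lemma sin_pos_imp_less_pi:
  fixes x :: real
  assumes "0 < sin x" "- pi < x" "x < 2 * pi"
  shows "0 < x" and "x < pi"
proof -
  show "0 < x"
  proof (rule ccontr)
    assume "\<not> 0 < x"
    then have "0 \<le> sin (- x)" using assms(2) by (intro sin_ge_zero) auto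
    then show False using assms(1) by simp
  qed
  show "x < pi"
    using assms(1,3) sin_le_zero[of x] by force
qed

text \<open>The deviation of the polar from the eccentric angle always has positive cosine and
  changes by less than \<open>pi\<close> per step, so it cannot leave the interval of length
  \<open>pi\<close> in which it starts.\<close>

lemma polar_angle_lift_ellipse_point_bound:
  assumes ab: "0 < a" "0 < b"
    and steps: "\<And>i. 0 < s (Suc i) - s i" "\<And>i. s (Suc i) - s i < pi"
    and lift: "polar_angle_lift (\<lambda>i. ellipse_point a b (s i)) \<theta>"
  shows "\<bar>(\<theta> N - \<theta> 0) - (s N - s 0)\<bar> \<le> pi"
proof -
  define D where "D i = \<theta> i - (s i + pi / 2)" for i
  have polar: "ellipse_point a b (s i) = rcis (cmod (ellipse_point a b (s i))) (\<theta> i)" for i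
    using lift by (simp add: polar_angle_lift_def)
  have cos_D: "0 < cos (D i)" for i
    unfolding D_def by (rule polar_angle_ellipse_point[OF ab polar])
  define m where "m = round (D 0 / (2 * pi))"
  have cos_D': "0 < cos (D i - 2 * pi * of_int m)" for i
    using cos_D by (simp add: cos_diff)
  have *: "\<bar>D i - 2 * pi * of_int m\<bar> < pi / 2" for i
  proof (induction i)
    case 0
    have "\<bar>of_int m - D 0 / (2 * pi)\<bar> \<le> 1 / 2"
      unfolding m_def by (rule of_int_round_abs_le)
    then have "\<bar>D 0 - 2 * pi * of_int m\<bar> \<le> pi"
      by (simp add: abs_le_iff field_simps)
    then show ?case
      using pi_gt_zero by (intro abs_less_pi_half_if_cos_pos cos_D') linarith
  next
    case (Suc i)
    \<comment> \<open>The lift alone allows steps up to \<open>2 * pi\<close>; the positive sine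
      cuts them down to less than \<open>pi\<close>.\<close>
    have "0 < sin (\<theta> (Suc i) - \<theta> i)"
      using sin_polar_angle_step[OF ab polar polar steps] .
    then have "0 < \<theta> (Suc i) - \<theta> i" "\<theta> (Suc i) - \<theta> i < pi"
      using lift sin_pos_imp_less_pi[of "\<theta> (Suc i) - \<theta> i"] pi_gt_zero
      unfolding polar_angle_lift_def by (smt (verit))+
    then have "\<bar>D (Suc i) - D i\<bar> < pi"
      using steps[of i] unfolding D_def by linarith
    then show ?case
      using Suc by (intro abs_less_pi_half_if_cos_pos cos_D') linarith
  qed
  then show ?thesis
    using *[of N] *[of 0] unfolding D_def by linarith
qed

text \<open>A lift must exist for the condition in \<open>rotation_number\<close> to determine the
  limit. It is the eccentric angle corrected by the principal argument of the point rotated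
  back.\<close>

lemma polar_angle_lift_ellipse_point_ex:
  assumes ab: "0 < a" "0 < b"
    and steps: "\<And>i. 0 < s (Suc i) - s i" "\<And>i. s (Suc i) - s i < pi"
  shows "\<exists>\<theta>. polar_angle_lift (\<lambda>i. ellipse_point a b (s i)) \<theta>"
proof -
  define z where "z i = ellipse_point a b (s i) * cis (- (s i + pi / 2))" for i
  define \<theta> where "\<theta> i = s i + pi / 2 + Arg (z i)" for i
  have polar: "ellipse_point a b (s i) = rcis (cmod (ellipse_point a b (s i))) (\<theta> i)" for i
  proof -
    have "ellipse_point a b (s i) = z i * cis (s i + pi / 2)"
      by (simp add: z_def mult.assoc cis_mult)
    also have "z i = rcis (cmod (ellipse_point a b (s i))) (Arg (z i))"
      using rcis_cmod_Arg[of "z i"] by (simp add: z_def norm_mult)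
    finally show ?thesis
      by (simp add: \<theta>_def rcis_def mult.assoc cis_mult add.commute)
  qed
  have Arg: "\<bar>Arg (z i)\<bar> < pi / 2" for i
  proof -
    have "0 < Re (z i)" unfolding z_def by (rule ellipse_point_rotated[OF ab])
    moreover from this have "z i \<noteq> 0" by auto
    ultimately show ?thesis using Re_Ln_pos_lt[of "z i"] Arg_eq_Im_Ln by metis
  qed
  have "0 < \<theta> (Suc i) - \<theta> i \<and> \<theta> (Suc i) - \<theta> i < 2 * pi" for i
  proof -
    have "0 < sin (\<theta> (Suc i) - \<theta> i)"
      by (rule sin_polar_angle_step[OF ab polar polar steps])
    moreover have "- pi < \<theta> (Suc i) - \<theta> i" "\<theta> (Suc i) - \<theta> i < 2 * pi"
      using Arg[of i] Arg[of "Suc i"] steps[of i] unfolding \<theta>_def by linarith+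
    ultimately show ?thesis using sin_pos_imp_less_pi(1) by blast
  qed
  then show ?thesis using polar unfolding polar_angle_lift_def by blast
qed

text \<open>The components along \<open>n\<close> and the orthogonal \<open>\<i> * n\<close>
  determine a plane vector; reflection negates the first and keeps the second.\<close>

lemma reflect_vec_eqI:
  assumes "n \<noteq> 0" and "v \<bullet> n = - (u \<bullet> n)" and "v \<bullet> (\<i> * n) = u \<bullet> (\<i> * n)"
  shows "v = reflect_vec n u"
proof -
  define w where "w = v - reflect_vec n u"
  have "n \<bullet> n \<noteq> 0" using assms(1) by simp
  then have "w \<bullet> n = 0"
    using assms(2) by (simp add: w_def reflect_vec_def inner_diff_left)
  moreover have "w \<bullet> (\<i> * n) = 0"
  proof -
    have "n \<bullet> (\<i> * n) = 0" by (simp add: inner_complex_def)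
    then show ?thesis using assms(3) by (simp add: w_def reflect_vec_def inner_diff_left)
  qed
  ultimately have "Re w * Re n + Im w * Im n = 0" "Im w * Re n = Re w * Im n"
    by (simp_all add: inner_complex_def)
  then have "Re w * (Re n * Re n + Im n * Im n) = 0" "Im w * (Re n * Re n + Im n * Im n) = 0"
    by algebra+
  then have "w = 0"
    using \<open>n \<bullet> n \<noteq> 0\<close> unfolding inner_complex_def mult_eq_0_iff by (auto simp: complex_eq_iff)
  then show ?thesis by (simp add: w_def)
qed

section \<open>Parameter sequences and directions of tangent chords\<close>

context confocal
begin

text \<open>Parameters live on the real line, not modulo \<open>2 * pi\<close>, so that increments
  add up over many turns.\<close>

definition chain :: "(nat \<Rightarrow> real) \<Rightarrow> bool" where
  "chain s \<longleftrightarrow> (\<forall>i. \<exists>\<sigma>. s i = \<sigma> - half_step \<sigma> \<and> s (Suc i) = \<sigma> + half_step \<sigma>)"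

lemma half_step_isCont: "isCont half_step \<sigma>"
  by (rule DERIV_isCont[OF half_step_has_real_derivative])

lemma half_step_continuous_on: "continuous_on A half_step"
  using half_step_isCont continuous_at_imp_continuous_on by blast

lemma step_ex: "\<exists>\<sigma>. u = \<sigma> - half_step \<sigma>"
proof -
  \<comment> \<open>As the half step lies between 0 and \<open>pi / 2\<close>, the function
    \<open>\<sigma> - half_step \<sigma>\<close> is below \<open>u\<close> at \<open>u\<close> and
    above it at \<open>u + pi / 2\<close>.\<close>
  have "\<exists>\<sigma>\<ge>u. \<sigma> \<le> u + pi / 2 \<and> \<sigma> - half_step \<sigma> = u"
    using half_step_pos[of u] half_step_less[of "u + pi / 2"]
    by (intro IVT') (auto intro!: continuous_intros half_step_continuous_on)
  then show ?thesis by force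
qed

lemma chain_ex: "\<exists>s. chain s"
  unfolding chain_def using dependent_nat_choice[of "\<lambda>_ _. True"
      "\<lambda>_ u v. \<exists>\<sigma>. u = \<sigma> - half_step \<sigma> \<and> v = \<sigma> + half_step \<sigma>"] step_ex
  by metis

lemma chain_steps:
  assumes "chain s"
  shows "0 < s (Suc i) - s i" and "s (Suc i) - s i < pi"
proof -
  obtain \<sigma> where "s i = \<sigma> - half_step \<sigma>" "s (Suc i) = \<sigma> + half_step \<sigma>"
    using assms unfolding chain_def by blast
  then show "0 < s (Suc i) - s i" and "s (Suc i) - s i < pi"
    using half_step_pos[of \<sigma>] half_step_less[of \<sigma>] by simp_all
qed

lemma ellipse_normal_P: "ellipse_normal (a\<^sup>2) (b\<^sup>2) (P t) = Complex (- sin t / a) (cos t / b)"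
  using a_pos b_pos by (simp add: ellipse_normal_def complex_eq_iff power2_eq_square)

lemma chord_direction:
  "sgn (P (\<sigma> + half_step \<sigma>) - P (\<sigma> - half_step \<sigma>))
     = (sqrt l / (a * b * sin (half_step \<sigma>))) *\<^sub>R Complex (- (a * cos \<sigma>)) (- (b * sin \<sigma>))"
proof -
  have "norm (Complex (- (a * cos \<sigma>)) (- (b * sin \<sigma>))) = a * b * sin (half_step \<sigma>) / sqrt l"
    using chord_norm_sq[of \<sigma>] a_pos b_pos sin_half_step_pos[of \<sigma>]
    by (simp add: cmod_def real_sqrt_divide)
  then show ?thesis
    using sin_half_step_pos[of \<sigma>]
    by (simp only: ellipse_point_diff sgn_scaleR sgn_div_norm) simp
qed

text \<open>The first two values are Joachimsthal's invariant: against the unnormalised normal,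
  every tangent chord has the same component up to sign. The tangential component depends on the
  vertex \<open>t\<close> alone, whether the chord arrives or leaves there.\<close>

lemma chord_direction_inner:
  fixes \<sigma> :: real
  defines "v \<equiv> sgn (P (\<sigma> + half_step \<sigma>) - P (\<sigma> - half_step \<sigma>))"
    and "n \<equiv> \<lambda>t. ellipse_normal (a\<^sup>2) (b\<^sup>2) (P t)"
  shows "v \<bullet> n (\<sigma> + half_step \<sigma>) = sqrt l / (a * b)"
    and "v \<bullet> n (\<sigma> - half_step \<sigma>) = - (sqrt l / (a * b))"
    and "t \<in> {\<sigma> + half_step \<sigma>, \<sigma> - half_step \<sigma>} \<Longrightarrow>
           v \<bullet> (\<i> * n t) = sqrt (a\<^sup>2 - l) / (a * b) * sqrt (1 - modulus\<^sup>2 * (sin t)\<^sup>2)"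
proof -
  have inner_n: "v \<bullet> n t = sqrt l / (a * b * sin (half_step \<sigma>)) * sin (t - \<sigma>)" for t
    unfolding v_def n_def ellipse_normal_P chord_direction inner_complex_def
    using a_pos b_pos sin_half_step_pos[of \<sigma>] by (simp add: sin_diff field_simps)
  show "v \<bullet> n (\<sigma> + half_step \<sigma>) = sqrt l / (a * b)"
    and "v \<bullet> n (\<sigma> - half_step \<sigma>) = - (sqrt l / (a * b))"
    unfolding inner_n using sin_half_step_pos[of \<sigma>] by simp_all
  let ?x = "sin (half_step \<sigma>)" and ?y = "cos (half_step \<sigma>)"
  have aux: "(a * cos \<sigma>)\<^sup>2 + (b * sin \<sigma>)\<^sup>2 = (a * b)\<^sup>2 / l * ?x\<^sup>2"
    unfolding chord_norm_sq by (simp add: power_mult_distrib)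
  have aux2: "(a\<^sup>2 - b\<^sup>2) * sin \<sigma> * cos \<sigma> = (a * b)\<^sup>2 / l * skew \<sigma>"
    unfolding skew_def using a_pos b_pos l_pos by (simp add: field_simps)
  have inner_t: "v \<bullet> (\<i> * n t) = sqrt l / (a * b * ?x) / (a * b)
      * (a\<^sup>2 * cos \<sigma> * cos t + b\<^sup>2 * sin \<sigma> * sin t)" for t
    unfolding v_def n_def ellipse_normal_P chord_direction inner_complex_def
    using a_pos b_pos sin_half_step_pos[of \<sigma>] by (simp add: field_simps power2_eq_square)
  \<comment> \<open>The addition formulas turn both endpoint expressions into combinations of the
    left-hand sides of \<open>aux\<close> and \<open>aux2\<close>.\<close>
  have "a\<^sup>2 * cos \<sigma> * cos (\<sigma> + half_step \<sigma>) + b\<^sup>2 * sin \<sigma> * sin (\<sigma> + half_step \<sigma>)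
      = (a * b)\<^sup>2 / l * ?x * (?x * ?y - skew \<sigma>)"
    unfolding cos_add sin_add using aux aux2 by algebra
  moreover have "a\<^sup>2 * cos \<sigma> * cos (\<sigma> - half_step \<sigma>) + b\<^sup>2 * sin \<sigma> * sin (\<sigma> - half_step \<sigma>)
      = (a * b)\<^sup>2 / l * ?x * (?x * ?y + skew \<sigma>)"
    unfolding cos_diff sin_diff using aux aux2 by algebra
  moreover have "sqrt l / (a * b * ?x) / (a * b) * ((a * b)\<^sup>2 / l * ?x * w)
      = sqrt (a\<^sup>2 - l) / (a * b) * (scale * w)" for w
    using a_pos b_pos l_pos l_less_a2 sin_half_step_pos[of \<sigma>]
      real_sqrt_mult_self[of l]
    by (simp add: field_simps power2_eq_square)
  ultimately show "v \<bullet> (\<i> * n t) = sqrt (a\<^sup>2 - l) / (a * b) * sqrt (1 - modulus\<^sup>2 * (sin t)\<^sup>2)"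
    if "t \<in> {\<sigma> + half_step \<sigma>, \<sigma> - half_step \<sigma>}"
    using that unfolding inner_t by (auto simp only: sqrt_modulus_step)
qed

section \<open>Trajectories as sequences of parameters\<close>

lemma ccw_tangent_step: "ccw_tangent (a\<^sup>2 - l) (b\<^sup>2 - l) (P (\<sigma> - half_step \<sigma>)) (P (\<sigma> + half_step \<sigma>))"
proof -
  define x where "x = sin (half_step \<sigma>)"
  define y where "y = cos (half_step \<sigma>)"
  \<comment> \<open>The chord line is
    \<open>- (X * sin \<sigma> / a) + Y * cos \<sigma> / b = y\<close>. Dividing by \<open>y\<close>
    and scaling the coefficients by \<open>a\<^sup>2 - l\<close> and \<open>b\<^sup>2 - l\<close>
    gives its pole with respect to the caustic, the contact point.\<close>
  define T where "T = Complex (- ((a\<^sup>2 - l) * sin \<sigma> / (a * y))) ((b\<^sup>2 - l) * cos \<sigma> / (b * y))"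
  have pos: "0 < x" "0 < y"
    unfolding x_def y_def by (rule sin_half_step_pos cos_half_step_pos)+
  have y2: "y\<^sup>2 = 1 - q \<sigma>"
    unfolding y_def cos_squared_eq sin_half_step_sq ..
  have y2': "a\<^sup>2 * b\<^sup>2 * y\<^sup>2 = (a\<^sup>2 - l) * b\<^sup>2 * (sin \<sigma>)\<^sup>2 + (b\<^sup>2 - l) * a\<^sup>2 * (cos \<sigma>)\<^sup>2"
  proof -
    have "a\<^sup>2 * b\<^sup>2 * q \<sigma> = l * (b\<^sup>2 * (sin \<sigma>)\<^sup>2 + a\<^sup>2 * (cos \<sigma>)\<^sup>2)"
      using a_pos b_pos by (simp add: field_simps)
    then show ?thesis unfolding y2 using sin_cos_squared_add[of \<sigma>] by algebra
  qed
  show ?thesis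
    unfolding ccw_tangent_def
  proof (intro bexI conjI exI)
    have "(Re T)\<^sup>2 / (a\<^sup>2 - l) = (a\<^sup>2 - l) * b\<^sup>2 * (sin \<sigma>)\<^sup>2 / (a\<^sup>2 * b\<^sup>2 * y\<^sup>2)"
      using l_less_a2 a_pos b_pos pos by (simp add: T_def field_simps power2_eq_square)
    moreover have "(Im T)\<^sup>2 / (b\<^sup>2 - l) = (b\<^sup>2 - l) * a\<^sup>2 * (cos \<sigma>)\<^sup>2 / (a\<^sup>2 * b\<^sup>2 * y\<^sup>2)"
      using l_less a_pos b_pos pos by (simp add: T_def field_simps power2_eq_square)
    ultimately show "T \<in> ellipse (a\<^sup>2 - l) (b\<^sup>2 - l)"
      using a_pos b_pos pos
      by (simp only: ellipse_def mem_Collect_eq flip: add_divide_distrib y2') simp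
    \<comment> \<open>The offset of the contact point from the midpoint of the chord, as a fraction
      of the chord.\<close>
    define \<nu> where "\<nu> = skew \<sigma> / (2 * x * y)"
    have \<nu>: "a\<^sup>2 * b\<^sup>2 * (2 * \<nu> * x * y) = l * (a\<^sup>2 - b\<^sup>2) * sin \<sigma> * cos \<sigma>"
      using a_pos b_pos pos by (simp add: \<nu>_def skew_def)
    have T: "Re T * (a * y) = - ((a\<^sup>2 - l) * sin \<sigma>)" "Im T * (b * y) = (b\<^sup>2 - l) * cos \<sigma>"
      using a_pos b_pos pos by (simp_all add: T_def)
    define Z where "Z = (1 / 2 - \<nu>) *\<^sub>R P (\<sigma> - half_step \<sigma>) + (1 / 2 + \<nu>) *\<^sub>R P (\<sigma> + half_step \<sigma>)"
    have Z: "Re Z = - a * (sin \<sigma> * y + 2 * \<nu> * cos \<sigma> * x)" "Im Z = b * (cos \<sigma> * y - 2 * \<nu> * sin \<sigma> * x)"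
      unfolding Z_def x_def y_def
      by (simp_all add: sin_add sin_diff cos_add cos_diff algebra_simps)
    have "a * b\<^sup>2 * y * Re T = a * b\<^sup>2 * y * Re Z" "a\<^sup>2 * b * y * Im T = a\<^sup>2 * b * y * Im Z"
      unfolding Z using T sin_cos_squared_add[of \<sigma>] y2' \<nu> by algebra+
    then have "T = Z" using a_pos b_pos pos by (simp add: complex_eq_iff)
    then show "T \<in> affine hull {P (\<sigma> - half_step \<sigma>), P (\<sigma> + half_step \<sigma>)}"
      unfolding affine_hull_2 Z_def by force
    show "0 < 2 * a * b * x * y" using a_pos b_pos pos by simp
    show "P (\<sigma> + half_step \<sigma>) - P (\<sigma> - half_step \<sigma>)
        = (2 * a * b * x * y) *\<^sub>R (\<i> * ellipse_normal (a\<^sup>2 - l) (b\<^sup>2 - l) T)"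
      unfolding ellipse_point_diff using l_less l_less_a2 a_pos b_pos pos
      by (simp add: complex_eq_iff ellipse_normal_def T_def x_def)
  qed
qed

text \<open>Each inner vertex ends one tangent chord and starts the next, so
  \<open>chord_direction_inner\<close> yields opposite normal and equal tangential
  components.\<close>

lemma circumscribing_chain:
  assumes "chain s"
  shows "circumscribing_trajectory a b l (\<lambda>i. P (s i))"
  unfolding circumscribing_trajectory_def billiard_trajectory_def
proof (intro conjI allI)
  fix i
  show "P (s i) \<in> ellipse (a\<^sup>2) (b\<^sup>2)"
    using a_pos b_pos by (simp add: ellipse_point_in_ellipse)
  obtain \<sigma> where \<sigma>: "s i = \<sigma> - half_step \<sigma>" "s (Suc i) = \<sigma> + half_step \<sigma>"
    using assms unfolding chain_def by blast
  obtain \<tau> where \<tau>: "s (Suc i) = \<tau> - half_step \<tau>" "s (Suc (Suc i)) = \<tau> + half_step \<tau>"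
    using assms unfolding chain_def by blast
  show "ccw_tangent (a\<^sup>2 - l) (b\<^sup>2 - l) (P (s i)) (P (s (Suc i)))"
    unfolding \<sigma> by (rule ccw_tangent_step)
  have "0 < dist (P (s i)) (P (s (Suc i)))"
    unfolding \<sigma> chord_length using a_pos b_pos l_pos q_pos[of \<sigma>] by simp
  then show "P (s (Suc i)) \<noteq> P (s i)" by auto
  let ?n = "ellipse_normal (a\<^sup>2) (b\<^sup>2) (P (s (Suc i)))"
  show "sgn (P (s (Suc (Suc i))) - P (s (Suc i)))
      = reflect_vec ?n (sgn (P (s (Suc i)) - P (s i)))"
  proof (rule reflect_vec_eqI)
    show "?n \<noteq> 0"
      using sin_zero_abs_cos_one[of "s (Suc i)"] a_pos b_pos
      by (auto simp: ellipse_normal_P complex_eq_iff)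
    have "sgn (P (s (Suc (Suc i))) - P (s (Suc i))) \<bullet> ?n = - (sqrt l / (a * b))"
      unfolding \<tau> by (rule chord_direction_inner)
    moreover have "sgn (P (s (Suc i)) - P (s i)) \<bullet> ?n = sqrt l / (a * b)"
      unfolding \<sigma> by (rule chord_direction_inner)
    ultimately show "sgn (P (s (Suc (Suc i))) - P (s (Suc i))) \<bullet> ?n
        = - (sgn (P (s (Suc i)) - P (s i)) \<bullet> ?n)" by simp
    show "sgn (P (s (Suc (Suc i))) - P (s (Suc i))) \<bullet> (\<i> * ?n)
        = sgn (P (s (Suc i)) - P (s i)) \<bullet> (\<i> * ?n)"
      using chord_direction_inner(3)[of "s (Suc i)" \<sigma>] chord_direction_inner(3)[of "s (Suc i)" \<tau>]
      by (simp flip: \<sigma> \<tau>)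
  qed
qed

text \<open>The contact point lies on the caustic and on the chord line. Eliminating its scale
  factor \<open>g\<close> from these two equations leaves
  \<open>(sin d)\<^sup>2 = q \<sigma>\<close>, and the orientation selects
  \<open>d < pi / 2\<close>.\<close>

lemma tangent_imp_step:
  assumes "v \<in> ellipse (a\<^sup>2) (b\<^sup>2)" and "ccw_tangent (a\<^sup>2 - l) (b\<^sup>2 - l) (P u) v"
  shows "\<exists>\<sigma>. u = \<sigma> - half_step \<sigma> \<and> v = P (\<sigma> + half_step \<sigma>)"
proof -
  have "a \<noteq> 0" "b \<noteq> 0" using a_pos b_pos by auto
  with assms(1) obtain s where s: "v = P s" "u \<le> s" "s < u + 2 * pi"
    by (rule ellipse_point_after)
  define \<sigma> where "\<sigma> = (u + s) / 2"
  define d where "d = (s - u) / 2"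
  have us: "u = \<sigma> - d" "s = \<sigma> + d" by (simp_all add: \<sigma>_def d_def field_simps)
  have d: "0 \<le> d" "d < pi" using s by (simp_all add: d_def)
  obtain T \<tau> where T: "T \<in> ellipse (a\<^sup>2 - l) (b\<^sup>2 - l)" "T \<in> affine hull {P u, v}" and "0 < \<tau>"
    and \<tau>: "v - P u = \<tau> *\<^sub>R (\<i> * ellipse_normal (a\<^sup>2 - l) (b\<^sup>2 - l) T)"
    using assms(2) unfolding ccw_tangent_def by blast
  have nz: "a\<^sup>2 - l \<noteq> 0" "b\<^sup>2 - l \<noteq> 0" using l_less l_less_a2 by auto
  \<comment> \<open>Comparing the chord direction with the normal at \<open>T\<close> determines
    \<open>T\<close> up to this factor.\<close>
  define g where "g = 2 * sin d / \<tau>"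
  have "2 * sin d * (a * cos \<sigma>) = \<tau> * (Im T / (b\<^sup>2 - l))" "2 * sin d * (b * sin \<sigma>) = - \<tau> * (Re T / (a\<^sup>2 - l))"
    using \<tau> unfolding s(1) us ellipse_point_diff ellipse_normal_def by (simp_all add: complex_eq_iff)
  then have ImT: "Im T = g * (b\<^sup>2 - l) * (a * cos \<sigma>)" and ReT: "Re T = - g * (a\<^sup>2 - l) * (b * sin \<sigma>)"
    using \<open>0 < \<tau>\<close> nz by (simp_all add: g_def field_simps)
  define M where "M = (a\<^sup>2 - l) * (b * sin \<sigma>)\<^sup>2 + (b\<^sup>2 - l) * (a * cos \<sigma>)\<^sup>2"
  have g2M: "g\<^sup>2 * M = 1"
  proof -
    have "(Re T)\<^sup>2 / (a\<^sup>2 - l) = g\<^sup>2 * (a\<^sup>2 - l) * (b * sin \<sigma>)\<^sup>2"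
      "(Im T)\<^sup>2 / (b\<^sup>2 - l) = g\<^sup>2 * (b\<^sup>2 - l) * (a * cos \<sigma>)\<^sup>2"
      unfolding ReT ImT using nz by (simp_all add: power_mult_distrib power2_eq_square)
    then show ?thesis
      using T(1) unfolding ellipse_def M_def by (simp add: algebra_simps)
  qed
  have "0 \<le> g" using d \<open>0 < \<tau>\<close> by (simp add: g_def sin_ge_zero)
  with g2M have "0 < g" by (metis less_eq_real_def mult_zero_left power_zero_numeral zero_neq_one)
  \<comment> \<open>Paired with the normal vector
    \<open>Complex (- (b * sin \<sigma>)) (a * cos \<sigma>)\<close> of the chord, both chord ends
    give \<open>a * b * cos d\<close>, hence so does every affine combination.\<close>
  have gM: "g * M = a * b * cos d"
  proof -
    obtain \<alpha> \<beta> where "\<alpha> + \<beta> = 1" "T = \<alpha> *\<^sub>R P u + \<beta> *\<^sub>R v"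
      using T(2) unfolding affine_hull_2 by blast
    then have "b * sin \<sigma> * - Re T + a * cos \<sigma> * Im T
        = a * b * (\<alpha> * cos (\<sigma> - u) + \<beta> * cos (s - \<sigma>))"
      unfolding s(1) by (simp add: cos_diff algebra_simps)
    also have "\<dots> = a * b * ((\<alpha> + \<beta>) * cos d)"
      unfolding us by (simp add: algebra_simps)
    finally show ?thesis
      unfolding \<open>\<alpha> + \<beta> = 1\<close> ReT ImT M_def by (simp add: algebra_simps power2_eq_square)
  qed
  have "0 < M" using g2M \<open>0 < g\<close> by (metis zero_less_mult_pos zero_less_one zero_less_power)
  with gM \<open>0 < g\<close> have "0 < cos d"
    using a_pos b_pos by (metis mult_pos_pos zero_less_mult_pos)
  then have "\<bar>d\<bar> < pi / 2"
    using d by (intro abs_less_pi_half_if_cos_pos) linarith+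
  then have "d < pi / 2" by simp
  have "d \<noteq> 0" using \<open>0 < g\<close> by (auto simp: g_def)
  have "M = (g * M)\<^sup>2" using g2M by (simp add: power2_eq_square)
  then have "(a * b)\<^sup>2 * (cos d)\<^sup>2 = M" unfolding gM by (simp add: power_mult_distrib)
  then have "(a * b)\<^sup>2 * (sin d)\<^sup>2 = (a * b)\<^sup>2 - M"
    unfolding cos_squared_eq right_diff_distrib by linarith
  also have "\<dots> = (a * b)\<^sup>2 * ((sin \<sigma>)\<^sup>2 + (cos \<sigma>)\<^sup>2) - M" by simp
  also have "\<dots> = (a * b)\<^sup>2 * q \<sigma>"
    unfolding M_def using a_pos b_pos
    by (simp add: field_simps del: sin_cos_squared_add sin_cos_squared_add2)
  finally have "(sin d)\<^sup>2 = q \<sigma>" using a_pos b_pos by simp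
  with d \<open>d \<noteq> 0\<close> \<open>d < pi / 2\<close> have "d = half_step \<sigma>" by (intro half_step_unique) auto
  then show ?thesis using us s(1) by auto
qed

lemma circumscribing_imp_chain:
  assumes "circumscribing_trajectory a b l Q"
  obtains s where "chain s" and "Q = (\<lambda>i. P (s i))"
proof -
  have Q: "Q i \<in> ellipse (a\<^sup>2) (b\<^sup>2)" "ccw_tangent (a\<^sup>2 - l) (b\<^sup>2 - l) (Q i) (Q (Suc i))" for i
    using assms unfolding circumscribing_trajectory_def billiard_trajectory_def by auto
  \<comment> \<open>Dependent choice, since each step must start from the very parameter already
    chosen for \<open>Q i\<close>.\<close>
  have "\<exists>s. \<forall>i. Q i = P (s i) \<and> (\<exists>\<sigma>. s i = \<sigma> - half_step \<sigma> \<and> s (Suc i) = \<sigma> + half_step \<sigma>)"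
  proof (rule dependent_nat_choice)
    show "\<exists>u. Q 0 = P u"
      using ellipse_point_after[OF Q(1)[of 0]] a_pos b_pos by (metis less_irrefl)
    show "\<exists>v. Q (Suc i) = P v \<and> (\<exists>\<sigma>. u = \<sigma> - half_step \<sigma> \<and> v = \<sigma> + half_step \<sigma>)"
      if "Q i = P u" for u i
      using tangent_imp_step[of "Q (Suc i)" u] Q(1)[of "Suc i"] Q(2)[of i] unfolding that by blast
  qed
  then show ?thesis using that unfolding chain_def by blast
qed

end

section \<open>Rotation number and mean length\<close>

lemma continuous_periodic_attains_inf:
  fixes h :: "real \<Rightarrow> real"
  assumes cont: "continuous_on UNIV h" and period: "\<And>x. h (x + p) = h x" and "0 < p"
  obtains z where "\<And>x. h z \<le> h x"
proof -
  have "\<exists>z\<in>{0..p}. \<forall>y\<in>{0..p}. h z \<le> h y"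
    using \<open>0 < p\<close> by (intro continuous_attains_inf continuous_on_subset[OF cont]) auto
  then obtain z where z: "\<And>y. y \<in> {0..p} \<Longrightarrow> h z \<le> h y" by blast
  have "h z \<le> h x" for x
  proof -
    obtain y where "y \<in> {0..p}" and "h y = h x"
      using periodic_attained[of h p x, OF period \<open>0 < p\<close>] .
    then show ?thesis using z[of y] by simp
  qed
  then show ?thesis using that by blast
qed

context confocal
begin

text \<open>The mean advance of the parameter per chord: F gains
  \<open>2 * elliptic_F (half_step 0) modulus\<close> along a chord and
  \<open>2 * complete_K modulus\<close> when the parameter grows by \<open>pi\<close>.\<close>

definition rate :: real where
  "rate = pi * elliptic_F (half_step 0) modulus / complete_K modulus"

lemma K_pos: "0 < complete_K modulus"
  by (rule complete_K_pos[OF modulus_sq_less_1])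

lemma elliptic_F_deviation:
  obtains C where "\<And>x y. \<bar>(elliptic_F x modulus - elliptic_F y modulus)
      - 2 * complete_K modulus / pi * (x - y)\<bar> \<le> C"
proof -
  have "continuous_on UNIV (\<lambda>x. elliptic_F x modulus)"
    using DERIV_isCont[OF elliptic_F_has_real_derivative[OF modulus_sq_less_1]]
    by (simp add: continuous_at_imp_continuous_on)
  then show ?thesis
    using continuous_quasiperiodic_bounded elliptic_F_plus_pi[OF modulus_sq_less_1] pi_gt_zero that
    by blast
qed

lemma elliptic_E_deviation:
  obtains C where "\<And>x y. \<bar>(elliptic_E x k - elliptic_E y k) - 2 * complete_E k / pi * (x - y)\<bar> \<le> C"
proof -
  have "continuous_on UNIV (\<lambda>x. elliptic_E x k)"
    using DERIV_isCont[OF elliptic_E_has_real_derivative]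
    by (simp add: continuous_at_imp_continuous_on)
  then show ?thesis
    using continuous_quasiperiodic_bounded elliptic_E_plus_pi pi_gt_zero that by blast
qed

lemma chain_elliptic_F:
  assumes "chain s"
  shows "elliptic_F (s N) modulus - elliptic_F (s 0) modulus
    = real N * (2 * elliptic_F (half_step 0) modulus)"
proof (induction N)
  case (Suc N)
  obtain \<sigma> where "s N = \<sigma> - half_step \<sigma>" "s (Suc N) = \<sigma> + half_step \<sigma>"
    using assms unfolding chain_def by blast
  then have "elliptic_F (s (Suc N)) modulus - elliptic_F (s N) modulus = 2 * elliptic_F (half_step 0) modulus"
    by (simp only: elliptic_F_step)
  then show ?case using Suc by (simp add: algebra_simps)
qed simp

text \<open>The increment of F after \<open>N\<close> chords is known exactly, and up to a bounded
  error it is a fixed multiple of the parameter increment.\<close>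

lemma chain_rate:
  assumes "chain s"
  obtains C where "\<And>N. \<bar>(s N - s 0) - real N * rate\<bar> \<le> C"
proof -
  define \<kappa> where "\<kappa> = 2 * complete_K modulus / pi"
  have "0 < \<kappa>" using K_pos by (simp add: \<kappa>_def)
  obtain C where C: "\<And>x y. \<bar>(elliptic_F x modulus - elliptic_F y modulus) - \<kappa> * (x - y)\<bar> \<le> C"
    using elliptic_F_deviation unfolding \<kappa>_def by blast
  have "\<bar>(s N - s 0) - real N * rate\<bar> \<le> C / \<kappa>" for N
  proof -
    have "\<bar>real N * (2 * elliptic_F (half_step 0) modulus) - \<kappa> * (s N - s 0)\<bar> \<le> C"
      using C[of "s N" "s 0"] unfolding chain_elliptic_F[OF assms] .
    also have "real N * (2 * elliptic_F (half_step 0) modulus) = \<kappa> * (real N * rate)"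
      using K_pos by (simp add: rate_def \<kappa>_def)
    finally have "\<kappa> * \<bar>(s N - s 0) - real N * rate\<bar> \<le> C"
      using \<open>0 < \<kappa>\<close> by (simp add: abs_mult abs_minus_commute flip: right_diff_distrib)
    then show ?thesis
      using \<open>0 < \<kappa>\<close> by (subst pos_le_divide_eq) (simp_all add: mult.commute)
  qed
  then show ?thesis using that by blast
qed

lemma chain_rotation:
  assumes "chain s" and "polar_angle_lift (\<lambda>i. P (s i)) \<theta>"
  shows "(\<lambda>N. (\<theta> N - \<theta> 0) / (2 * pi * real N)) \<longlonglongrightarrow> rate / (2 * pi)"
proof -
  obtain C where C: "\<And>N. \<bar>(s N - s 0) - real N * rate\<bar> \<le> C"
    using chain_rate[OF assms(1)] by blast
  have "\<bar>(\<theta> N - \<theta> 0) - real N * rate\<bar> \<le> C + pi" for N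
    using C[of N] polar_angle_lift_ellipse_point_bound[where s = s and N = N, OF a_pos b_pos chain_steps[OF assms(1)] assms(2)]
    by linarith
  then have "(\<lambda>N. (\<theta> N - \<theta> 0) / real N) \<longlonglongrightarrow> rate"
    by (rule bounded_deviation_LIMSEQ)
  then have "(\<lambda>N. (\<theta> N - \<theta> 0) / real N / (2 * pi)) \<longlonglongrightarrow> rate / (2 * pi)"
    by (intro tendsto_divide tendsto_const) auto
  then show ?thesis by (simp add: mult.commute)
qed

lemma rotation_number_eq: "rotation_number a b l = rate / (2 * pi)"
  unfolding rotation_number_def
proof (rule the_equality)
  show "\<forall>Q \<theta>. circumscribing_trajectory a b l Q \<longrightarrow> polar_angle_lift Q \<theta> \<longrightarrow>
      (\<lambda>N. (\<theta> N - \<theta> 0) / (2 * pi * real N)) \<longlonglongrightarrow> rate / (2 * pi)"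
    using chain_rotation circumscribing_imp_chain by metis
next
  fix \<rho>
  assume \<rho>: "\<forall>Q \<theta>. circumscribing_trajectory a b l Q \<longrightarrow> polar_angle_lift Q \<theta> \<longrightarrow>
      (\<lambda>N. (\<theta> N - \<theta> 0) / (2 * pi * real N)) \<longlonglongrightarrow> \<rho>"
  \<comment> \<open>One actual trajectory with a lift forces the value of
    \<open>\<rho>\<close>.\<close>
  obtain s where s: "chain s" using chain_ex by blast
  obtain \<theta> where \<theta>: "polar_angle_lift (\<lambda>i. P (s i)) \<theta>"
    using polar_angle_lift_ellipse_point_ex[where s = s, OF a_pos b_pos chain_steps[OF s]] by blast
  show "\<rho> = rate / (2 * pi)"
    using \<rho> circumscribing_chain[OF s] \<theta> chain_rotation[OF s \<theta>] LIMSEQ_unique by blast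
qed

definition mean_length :: real where
  "mean_length = 2 * a * sqrt l / b - 2 * sqrt (a\<^sup>2 - l) / complete_K modulus *
     (complete_K modulus * elliptic_E (half_step 0) modulus
       - complete_E modulus * elliptic_F (half_step 0) modulus)"

text \<open>On average E gains \<open>2 * complete_E modulus / pi\<close> per unit of the parameter,
  and the parameter gains \<open>rate\<close> per chord.\<close>

lemma mean_length_altdef:
  "mean_length = base_length + sqrt (a\<^sup>2 - l) * (2 * complete_E modulus / pi * rate)"
  using K_pos by (simp add: mean_length_def base_length_def rate_def field_simps)

lemma chain_length:
  assumes "chain s"
  shows "(\<Sum>i=1..N. dist (P (s (i - 1))) (P (s i))) = real N * base_length
    + sqrt (a\<^sup>2 - l) * (elliptic_E (s N) modulus - elliptic_E (s 0) modulus)"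
proof (induction N)
  case (Suc N)
  obtain \<sigma> where "s N = \<sigma> - half_step \<sigma>" "s (Suc N) = \<sigma> + half_step \<sigma>"
    using assms unfolding chain_def by blast
  then have "dist (P (s N)) (P (s (Suc N))) = base_length
      + sqrt (a\<^sup>2 - l) * (elliptic_E (s (Suc N)) modulus - elliptic_E (s N) modulus)"
    by (simp only: chord_length_elliptic_E)
  then show ?case using Suc by (simp add: algebra_simps)
qed simp

lemma circumscribing_mean_length:
  assumes "circumscribing_trajectory a b l Q"
  shows "(\<lambda>N. (\<Sum>i=1..N. dist (Q (i - 1)) (Q i)) / real N) \<longlonglongrightarrow> mean_length"
proof -
  obtain s where s: "chain s" and Q: "Q = (\<lambda>i. P (s i))"
    using circumscribing_imp_chain[OF assms] .
  define \<epsilon> where "\<epsilon> = 2 * complete_E modulus / pi"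
  let ?A = "sqrt (a\<^sup>2 - l)"
  obtain C where C: "\<And>N. \<bar>(s N - s 0) - real N * rate\<bar> \<le> C"
    using chain_rate[OF s] by blast
  obtain D where D: "\<And>x y. \<bar>(elliptic_E x modulus - elliptic_E y modulus) - \<epsilon> * (x - y)\<bar> \<le> D"
    using elliptic_E_deviation unfolding \<epsilon>_def by blast
  have "\<bar>(\<Sum>i=1..N. dist (Q (i - 1)) (Q i)) - real N * mean_length\<bar> \<le> ?A * (D + \<bar>\<epsilon>\<bar> * C)" for N
  proof -
    let ?d = "elliptic_E (s N) modulus - elliptic_E (s 0) modulus"
    \<comment> \<open>The error splits into that of replacing E by its linear part and that of
      replacing the parameter by its mean advance.\<close>
    have "(\<Sum>i=1..N. dist (Q (i - 1)) (Q i)) - real N * mean_length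
        = ?A * ((?d - \<epsilon> * (s N - s 0)) + \<epsilon> * ((s N - s 0) - real N * rate))"
      unfolding Q chain_length[OF s] mean_length_altdef \<epsilon>_def[symmetric] by (simp add: algebra_simps)
    also have "\<bar>\<dots>\<bar> \<le> ?A * (D + \<bar>\<epsilon>\<bar> * C)"
      unfolding abs_mult[of ?A]
      using D[of "s N" "s 0"] mult_left_mono[OF C[of N] abs_ge_zero[of \<epsilon>]] l_less_a2
      by (intro mult_mono order.trans[OF abs_triangle_ineq] add_mono) (auto simp: abs_mult)
    finally show ?thesis .
  qed
  then show ?thesis by (rule bounded_deviation_LIMSEQ)
qed

end

text \<open>The arc cut off by a tangent of a smaller caustic is longer when measured in the invariant
  coordinate of the larger one; by compactness it exceeds the constant step uniformly, so the
  rates differ.\<close>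

lemma rate_strict_mono:
  assumes "confocal a b l" and "confocal a b l'" and "l < l'"
  shows "confocal.rate a b l < confocal.rate a b l'"
proof -
  interpret X: confocal a b l by fact
  interpret Y: confocal a b l' by fact
  define F where "F x = elliptic_F x X.modulus" for x
  let ?c = "2 * F (X.half_step 0)"
  define h where "h \<sigma> = F (\<sigma> + Y.half_step \<sigma>) - F (\<sigma> - Y.half_step \<sigma>)" for \<sigma>
  have F_cont: "continuous_on UNIV F"
    using DERIV_isCont[OF elliptic_F_has_real_derivative[OF X.modulus_sq_less_1]]
    by (simp add: F_def[abs_def] continuous_at_imp_continuous_on)
  have F_period: "F (x + pi) = F x + 2 * complete_K X.modulus" for x
    unfolding F_def by (rule elliptic_F_plus_pi[OF X.modulus_sq_less_1])
  have F_mono: "x < y \<Longrightarrow> F x < F y" for x y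
    unfolding F_def by (rule elliptic_F_strict_mono[OF X.modulus_sq_less_1])
  have "continuous_on UNIV h"
    unfolding h_def
    by (intro continuous_intros continuous_on_compose2[OF F_cont] Y.half_step_continuous_on) auto
  moreover have "h (\<sigma> + pi) = h \<sigma>" for \<sigma>
    using F_period[of "\<sigma> + Y.half_step \<sigma>"] F_period[of "\<sigma> - Y.half_step \<sigma>"]
    unfolding h_def Y.half_step_periodic by (simp add: algebra_simps)
  \<comment> \<open>The minimum over a period supplies one gap valid for all steps, which survives
    the passage to the mean.\<close>
  ultimately obtain z where z: "\<And>\<sigma>. h z \<le> h \<sigma>"
    using continuous_periodic_attains_inf[of h pi] pi_gt_zero by blast
  have "X.half_step z < Y.half_step z"
  proof -
    have "X.q z < Y.q z"
      using X.q_pos[of z] \<open>l < l'\<close> X.l_pos by (intro mult_strict_right_mono) (auto simp: zero_less_mult_iff)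
    then have "sqrt (X.q z) < sqrt (Y.q z)" by simp
    then show ?thesis
      unfolding X.half_step_def Y.half_step_def
      using X.sqrt_q_bounds[of z] Y.sqrt_q_bounds[of z] by (intro arcsin_less_arcsin) linarith+
  qed
  \<comment> \<open>Around the same midpoint \<open>z\<close> the chord tangent to the larger
    caustic spans a strictly smaller parameter interval, on which F gains exactly
    \<open>?c\<close>.\<close>
  then have "?c < h z"
    using X.elliptic_F_step[of z] F_mono[of "z + X.half_step z" "z + Y.half_step z"]
      F_mono[of "z - Y.half_step z" "z - X.half_step z"]
    unfolding h_def F_def by simp
  obtain s where s: "Y.chain s" using Y.chain_ex by blast
  have grow: "real N * h z \<le> F (s N) - F (s 0)" for N
  proof (induction N)
    case (Suc N)
    obtain \<sigma> where "s N = \<sigma> - Y.half_step \<sigma>" "s (Suc N) = \<sigma> + Y.half_step \<sigma>"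
      using s unfolding Y.chain_def by blast
    then have "h z \<le> F (s (Suc N)) - F (s N)" using z[of \<sigma>] by (simp only: h_def)
    then show ?case using Suc by (simp add: algebra_simps)
  qed simp
  obtain C where C: "\<And>N. \<bar>(s N - s 0) - real N * Y.rate\<bar> \<le> C"
    using Y.chain_rate[OF s] by blast
  define \<kappa> where "\<kappa> = 2 * complete_K X.modulus / pi"
  obtain D where D: "\<And>x y. \<bar>(F x - F y) - \<kappa> * (x - y)\<bar> \<le> D"
    using X.elliptic_F_deviation unfolding F_def \<kappa>_def by blast
  have "\<kappa> > 0" using X.K_pos by (simp add: \<kappa>_def)
  \<comment> \<open>Along \<open>s\<close> F gains at least \<open>h z\<close> per step, but up to a
    bounded error only \<open>\<kappa> * Y.rate\<close> on average. A positive difference would make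
    the left-hand side unbounded.\<close>
  have bound: "real N * (h z - \<kappa> * Y.rate) \<le> D + \<kappa> * C" for N
  proof -
    have "\<kappa> * ((s N - s 0) - real N * Y.rate) \<le> \<kappa> * C"
      using C[of N] \<open>\<kappa> > 0\<close> by (intro mult_left_mono) auto
    moreover have "real N * h z - \<kappa> * (s N - s 0) \<le> D"
      using grow[of N] D[of "s N" "s 0"] by linarith
    ultimately show ?thesis by (simp add: algebra_simps)
  qed
  have "h z \<le> \<kappa> * Y.rate"
  proof (rule ccontr)
    assume "\<not> h z \<le> \<kappa> * Y.rate"
    then obtain N where "D + \<kappa> * C < real N * (h z - \<kappa> * Y.rate)"
      using reals_Archimedean3[of "h z - \<kappa> * Y.rate"] by auto
    then show False using bound[of N] by simp
  qed
  moreover have "?c = \<kappa> * X.rate"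
    using X.K_pos by (simp add: X.rate_def F_def \<kappa>_def)
  ultimately have "\<kappa> * X.rate < \<kappa> * Y.rate" using \<open>?c < h z\<close> by simp
  then show ?thesis using \<open>\<kappa> > 0\<close> by (simp only: mult_less_cancel_left_pos)
qed

text \<open>The definition ranges over all caustics with the given rotation number; strict
  monotonicity of the rate leaves a single one, and an existing trajectory makes the limit
  unique.\<close>

lemma mather_beta_rotation_number:
  assumes "confocal a b l"
  shows "mather_beta a b (rotation_number a b l) = confocal.mean_length a b l"
proof -
  interpret confocal a b l by fact
  have same: "l' = l"
    if "0 < l'" "l' < b\<^sup>2" "rotation_number a b l' = rotation_number a b l" for l'
  proof -
    have l': "confocal a b l'"
      using that b_pos b_less_a by unfold_locales
    have "confocal.rate a b l' = rate"
      using that(3) unfolding rotation_number_eq confocal.rotation_number_eq[OF l'] by simp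
    then show ?thesis
      using rate_strict_mono[OF assms l'] rate_strict_mono[OF l' assms] by (cases l' l rule: linorder_cases) auto
  qed
  obtain s where s: "chain s" using chain_ex by blast
  show ?thesis
    unfolding mather_beta_def
  proof (rule the_equality)
    show "\<forall>l' Q. 0 < l' \<longrightarrow> l' < b\<^sup>2 \<longrightarrow> rotation_number a b l' = rotation_number a b l \<longrightarrow>
        circumscribing_trajectory a b l' Q \<longrightarrow>
        (\<lambda>N. (\<Sum>i=1..N. dist (Q (i - 1)) (Q i)) / real N) \<longlonglongrightarrow> mean_length"
      using same circumscribing_mean_length by blast
  next
    fix L
    assume "\<forall>l' Q. 0 < l' \<longrightarrow> l' < b\<^sup>2 \<longrightarrow> rotation_number a b l' = rotation_number a b l \<longrightarrow>
        circumscribing_trajectory a b l' Q \<longrightarrow>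
        (\<lambda>N. (\<Sum>i=1..N. dist (Q (i - 1)) (Q i)) / real N) \<longlonglongrightarrow> L"
    then show "L = mean_length"
      using circumscribing_chain[OF s] circumscribing_mean_length l_pos l_less LIMSEQ_unique by blast
  qed
qed

theorem theorem2p1:
  fixes a b c e f k l \<rho> \<phi> :: real
  assumes "0 < b" and "b < a"
    and "0 < l" and "l < b\<^sup>2"
    and "c = sqrt (a\<^sup>2 - b\<^sup>2)"
    and "e = a / c"
    and "f = sqrt (a\<^sup>2 - l) / c"
    and "\<rho> = rotation_number a b l"
    and "k = 1 / f"
    and "\<phi> = arcsin (sqrt ((e\<^sup>2 - f\<^sup>2) / (e\<^sup>2 - 1)))"
  shows "mather_beta a b \<rho> =
           2 * c * e * sqrt (e\<^sup>2 - f\<^sup>2) / sqrt (e\<^sup>2 - 1)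
           - 2 * c * f / complete_K k *
             (complete_K k * elliptic_E \<phi> k - complete_E k * elliptic_F \<phi> k)
         \<and> \<phi> = arcsin (sqrt l / b)"
proof -
  interpret confocal a b l by unfold_locales fact+
  have c2: "c\<^sup>2 = a\<^sup>2 - b\<^sup>2" and "0 < c"
    using b2_less_a2 unfolding assms(5) by simp_all
  \<comment> \<open>The common denominator \<open>c\<^sup>2\<close> cancels in the quotient, which
    becomes \<open>l / b\<^sup>2\<close>.\<close>
  have ef: "e\<^sup>2 - f\<^sup>2 = l / c\<^sup>2" "e\<^sup>2 - 1 = b\<^sup>2 / c\<^sup>2"
    using l_less_a2 \<open>0 < c\<close> c2 unfolding assms(6,7)
    by (simp_all add: power_divide field_simps)
  have "sqrt (e\<^sup>2 - f\<^sup>2) = sqrt l / c" "sqrt (e\<^sup>2 - 1) = b / c"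
    unfolding ef using \<open>0 < c\<close> b_pos by (simp_all add: real_sqrt_divide)
  then have quot: "sqrt (e\<^sup>2 - f\<^sup>2) / sqrt (e\<^sup>2 - 1) = sqrt l / b"
    using \<open>0 < c\<close> by simp
  have "c * e = a" unfolding assms(6) using \<open>0 < c\<close> by simp
  have \<phi>: "\<phi> = arcsin (sqrt l / b)"
    unfolding assms(10) real_sqrt_divide quot ..
  have k: "k = modulus"
    unfolding assms(9,7,5) modulus_def by simp
  have "2 * c * e * sqrt (e\<^sup>2 - f\<^sup>2) / sqrt (e\<^sup>2 - 1) = 2 * (c * e) * (sqrt (e\<^sup>2 - f\<^sup>2) / sqrt (e\<^sup>2 - 1))"
    by simp
  also have "\<dots> = 2 * a * sqrt l / b"
    unfolding quot \<open>c * e = a\<close> by simp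
  finally have "2 * c * e * sqrt (e\<^sup>2 - f\<^sup>2) / sqrt (e\<^sup>2 - 1) = 2 * a * sqrt l / b" .
  moreover have "c * f = sqrt (a\<^sup>2 - l)"
    unfolding assms(7) using \<open>0 < c\<close> by simp
  ultimately show ?thesis
    using mather_beta_rotation_number[OF confocal_axioms]
    unfolding assms(8) mean_length_def half_step_0 k \<phi> by (simp add: mult.assoc)
qed

end
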